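(* Let $m\geq 2$ be an integer, let $(\mathcal H_i)_{0\leq i\leq m}$ be nonzero real Hilbert spaces and, for every $i\in\{1,\ldots,m\}$, let $W_i\colon\mathcal H_{i-1}\to\mathcal H_i$ be a bounded linear operator, let $b_i\in\mathcal H_i$, let $\alpha_i\in[0,1]$, and let $R_i\colon\mathcal H_i\to\mathcal H_i$ be an $\alpha_i$-averaged operator. Set $T=T_m\circ\cdots\circ T_1$, where, for every $i\in\{1,\ldots,m\}$, $T_i\colon\mathcal H_{i-1}\to\mathcal H_i\colon x\mapsto R_i(W_ix+b_i)$. For every $i\in\{1,\ldots,m\}$, suppose that $\mathcal H_i$ is separable, let $\varnothing\neq\mathbb K_i\subset\mathbb N$, let $E_i=(e_{i,k})_{k\in\mathbb K_i}$ be an orthonormal basis of $\mathcal H_i$, and, for every $k\in\mathbb K_i$, let $\varrho_{i,k}\colon\mathbb R\to\mathbb R$ be $\alpha_i$-averaged and such that $\varrho_{i,k}(0)=0$. Let $\mathcal G_0$ be the normed space obtained by equipping the vector space underlying $\mathcal H_0$ with a norm for which $\mathcal G_0$ is continuously embedded in $\mathcal H_0$, and let $\mathcal G_m$ be the normed space obtained by equipping the vector space underlying $\mathcal H_m$ with a norm for which $\mathcal H_m$ is continuously embedded in $\mathcal G_m$. Assume that $$(\forall i\in\{1,\ldots,m\})\quad R_i\colon\mathcal H_i\to\mathcal H_i\colon x\mapsto\sum_{k\in\mathbb K_i}\varrho_{i,k}(\langle x\mid e_{i,k}\rangle)e_{i,k}.$$ Then $$\vartheta_m=\sup\big\{\|\Lambda_m\circ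 W_m\circ\cdots\circ\Lambda_1\circ W_1\|_{\mathcal G_0,\mathcal G_m}\;:\;\Lambda_i\in\mathscr D_{\{1-2\alpha_i,1\}}(E_i)\text{ for every }i\in\{1,\ldots,m\}\big\}$$ is a Lipschitz constant of $T\colon\mathcal G_0\to\mathcal G_m$.
   Context: An operator $R\colon\mathcal H\to\mathcal H$ on a real Hilbert space is nonexpansive if it is $1$-Lipschitzian; for $\alpha\in[0,1]$, it is $\alpha$-averaged if there exists a nonexpansive operator $Q\colon\mathcal H\to\mathcal H$ such that $R=(1-\alpha)\mathrm{Id}+\alpha Q$ (this applies in particular to $\mathcal H=\mathbb R$). A Lipschitz constant of $T\colon\mathcal G_0\to\mathcal G_m$ is any $\theta\geq 0$ such that $\|Tx-Ty\|_{\mathcal G_m}\leq\theta\|x-y\|_{\mathcal G_0}$ for all $x,y$ (not necessarily the smallest one). $\|\cdot\|_{\mathcal G_0,\mathcal G_m}$ denotes the operator norm of linear operators from $\mathcal G_0$ to $\mathcal G_m$. A normed space is continuously embedded in another one with the same underlying vector space if the identity map from the former to the latter is continuous. For an orthonormal basis $E=(e_k)_{k\in\mathbb K}$ of a separable real Hilbert space $\mathcal H$ and a nonempty bounded set $I\subset\mathbb R$, $\mathscr D_I(E)$ is the set of operators $\Lambda\colon\mathcal H\to\mathcal H\colon x\mapsto\sum_{k\in\mathbb K}\lambda_k\langle x\mid e_k\rangle e_k$ with $\{\lambda_k\}_{k\in\mathbb K}\subset I$. *)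

theory Defs
  imports "HOL-Analysis.Analysis" "HOL-Algebra.Module"
begin

text \<open>
  The spaces form a family indexed by natural numbers, so they cannot be types: a real vector
  space is a module, in the sense of HOL-Algebra, over the field of real numbers, with an explicit
  carrier set. The multiplication and unit fields that the module record inherits from the ring
  record are unconstrained by the module axioms and are never used.
\<close>

definition real_ring :: "real ring"
  where "real_ring =
    \<lparr>carrier = UNIV, monoid.mult = (*), one = 1, ring.zero = 0, add = (+)\<rparr>"

abbreviation real_vector_space :: "(real, 'a, 'b) module_scheme \<Rightarrow> bool"
  where "real_vector_space V \<equiv> Module.module real_ring V"

subsection \<open>Normed spaces\<close>

definition vector_norm :: "(real, 'a, 'b) module_scheme \<Rightarrow> ('a \<Rightarrow> real) \<Rightarrow> bool"
  where "vector_norm V N \<longleftrightarrow>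
    (\<forall>x\<in>carrier V. 0 \<le> N x) \<and>
    (\<forall>x\<in>carrier V. N x = 0 \<longleftrightarrow> x = \<zero>\<^bsub>V\<^esub>) \<and>
    (\<forall>r. \<forall>x\<in>carrier V. N (r \<odot>\<^bsub>V\<^esub> x) = \<bar>r\<bar> * N x) \<and>
    (\<forall>x\<in>carrier V. \<forall>y\<in>carrier V. N (x \<oplus>\<^bsub>V\<^esub> y) \<le> N x + N y)"

text \<open>The value outside the carrier is irrelevant; it is set to 0 because the locale
  \<open>Metric_space\<close> demands symmetry and nonnegativity on the whole type.\<close>

definition norm_dist :: "(real, 'a, 'b) module_scheme \<Rightarrow> ('a \<Rightarrow> real) \<Rightarrow> 'a \<Rightarrow> 'a \<Rightarrow> real"
  where "norm_dist V N x y =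
    (if x \<in> carrier V \<and> y \<in> carrier V then N (x \<ominus>\<^bsub>V\<^esub> y) else 0)"

definition norm_topology :: "(real, 'a, 'b) module_scheme \<Rightarrow> ('a \<Rightarrow> real) \<Rightarrow> 'a topology"
  where "norm_topology V N = Metric_space.mtopology (carrier V) (norm_dist V N)"

definition continuously_embedded ::
  "(real, 'a, 'b) module_scheme \<Rightarrow> ('a \<Rightarrow> real) \<Rightarrow> ('a \<Rightarrow> real) \<Rightarrow> bool"
  where "continuously_embedded V N N' \<longleftrightarrow>
    continuous_map (norm_topology V N) (norm_topology V N') (\<lambda>x. x)"

definition linear_operator ::
  "(real, 'a, 'c) module_scheme \<Rightarrow> (real, 'b, 'd) module_scheme \<Rightarrow> ('a \<Rightarrow> 'b) \<Rightarrow> bool"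
  where "linear_operator U V L \<longleftrightarrow>
    L \<in> carrier U \<rightarrow> carrier V \<and>
    (\<forall>x\<in>carrier U. \<forall>y\<in>carrier U. L (x \<oplus>\<^bsub>U\<^esub> y) = L x \<oplus>\<^bsub>V\<^esub> L y) \<and>
    (\<forall>r. \<forall>x\<in>carrier U. L (r \<odot>\<^bsub>U\<^esub> x) = r \<odot>\<^bsub>V\<^esub> L x)"

text \<open>Operator norm of a linear operator defined on the space \<open>(V, N)\<close> and with values in a space
  normed by \<open>N'\<close>. It is infinite if the operator is unbounded.\<close>

definition operator_norm ::
  "(real, 'a, 'c) module_scheme \<Rightarrow> ('a \<Rightarrow> real) \<Rightarrow> ('b \<Rightarrow> real) \<Rightarrow> ('a \<Rightarrow> 'b) \<Rightarrow> ereal"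
  where "operator_norm V N N' L = (SUP x\<in>{x \<in> carrier V. N x \<le> 1}. ereal (N' (L x)))"

definition lipschitz_constant ::
  "(real, 'a, 'c) module_scheme \<Rightarrow> ('a \<Rightarrow> real) \<Rightarrow> (real, 'b, 'd) module_scheme \<Rightarrow> ('b \<Rightarrow> real)
    \<Rightarrow> ('a \<Rightarrow> 'b) \<Rightarrow> real \<Rightarrow> bool"
  where "lipschitz_constant U N V N' T \<theta> \<longleftrightarrow>
    0 \<le> \<theta> \<and>
    (\<forall>x\<in>carrier U. \<forall>y\<in>carrier U. N' (T x \<ominus>\<^bsub>V\<^esub> T y) \<le> \<theta> * N (x \<ominus>\<^bsub>U\<^esub> y))"

subsection \<open>Hilbert spaces\<close>

record 'a inner_space = "(real, 'a) module" +
  ip :: "'a \<Rightarrow> 'a \<Rightarrow> real"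

definition inner_product_space :: "'a inner_space \<Rightarrow> bool"
  where "inner_product_space H \<longleftrightarrow>
    real_vector_space H \<and>
    (\<forall>x\<in>carrier H. \<forall>y\<in>carrier H. ip H x y = ip H y x) \<and>
    (\<forall>x\<in>carrier H. \<forall>y\<in>carrier H. \<forall>z\<in>carrier H. ip H (x \<oplus>\<^bsub>H\<^esub> y) z = ip H x z + ip H y z) \<and>
    (\<forall>r. \<forall>x\<in>carrier H. \<forall>y\<in>carrier H. ip H (r \<odot>\<^bsub>H\<^esub> x) y = r * ip H x y) \<and>
    (\<forall>x\<in>carrier H. x \<noteq> \<zero>\<^bsub>H\<^esub> \<longrightarrow> 0 < ip H x x)"

definition hnorm :: "'a inner_space \<Rightarrow> 'a \<Rightarrow> real"
  where "hnorm H x = sqrt (ip H x x)"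

abbreviation hilbert_topology :: "'a inner_space \<Rightarrow> 'a topology"
  where "hilbert_topology H \<equiv> norm_topology H (hnorm H)"

definition hilbert_space :: "'a inner_space \<Rightarrow> bool"
  where "hilbert_space H \<longleftrightarrow>
    inner_product_space H \<and> Metric_space.mcomplete (carrier H) (norm_dist H (hnorm H))"

definition bounded_operator :: "'a inner_space \<Rightarrow> 'b inner_space \<Rightarrow> ('a \<Rightarrow> 'b) \<Rightarrow> bool"
  where "bounded_operator H H' W \<longleftrightarrow>
    linear_operator H H' W \<and> (\<exists>C. \<forall>x\<in>carrier H. hnorm H' (W x) \<le> C * hnorm H x)"

text \<open>\<open>s\<close> is the sum of the series \<open>\<Sum>k\<in>K. f k\<close>, as the limit in norm of the net of sums over
  the finite subsets of \<open>K\<close> (as in \<open>has_sum\<close>). For an orthogonal family this is the same as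
  convergence of the series in any enumeration of \<open>K\<close>.\<close>

definition has_hilbert_sum :: "'a inner_space \<Rightarrow> ('k \<Rightarrow> 'a) \<Rightarrow> 'k set \<Rightarrow> 'a \<Rightarrow> bool"
  where "has_hilbert_sum H f K s \<longleftrightarrow>
    limitin (hilbert_topology H) (\<lambda>F. finsum H f F) s (finite_subsets_at_top K)"

definition finite_combinations :: "'a inner_space \<Rightarrow> 'k set \<Rightarrow> ('k \<Rightarrow> 'a) \<Rightarrow> 'a set"
  where "finite_combinations H K e =
    {finsum H (\<lambda>k. c k \<odot>\<^bsub>H\<^esub> e k) F |c F. finite F \<and> F \<subseteq> K}"

definition orthonormal_basis :: "'a inner_space \<Rightarrow> 'k set \<Rightarrow> ('k \<Rightarrow> 'a) \<Rightarrow> bool"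
  where "orthonormal_basis H K e \<longleftrightarrow>
    (\<forall>k\<in>K. e k \<in> carrier H) \<and>
    (\<forall>j\<in>K. \<forall>k\<in>K. ip H (e j) (e k) = (if j = k then 1 else 0)) \<and>
    hilbert_topology H closure_of finite_combinations H K e = carrier H"

definition diagonal_operators ::
  "'a inner_space \<Rightarrow> 'k set \<Rightarrow> ('k \<Rightarrow> 'a) \<Rightarrow> real set \<Rightarrow> ('a \<Rightarrow> 'a) set"
  where "diagonal_operators H K e I =
    {\<Lambda>. \<Lambda> \<in> carrier H \<rightarrow> carrier H \<and>
      (\<exists>c. (\<forall>k\<in>K. c k \<in> I) \<and>
        (\<forall>x\<in>carrier H. has_hilbert_sum H (\<lambda>k. (c k * ip H x (e k)) \<odot>\<^bsub>H\<^esub> e k) K (\<Lambda> x)))}"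

subsection \<open>Averaged operators\<close>

definition nonexpansive :: "'a inner_space \<Rightarrow> ('a \<Rightarrow> 'a) \<Rightarrow> bool"
  where "nonexpansive H Q \<longleftrightarrow>
    Q \<in> carrier H \<rightarrow> carrier H \<and> lipschitz_constant H (hnorm H) H (hnorm H) Q 1"

definition averaged :: "'a inner_space \<Rightarrow> real \<Rightarrow> ('a \<Rightarrow> 'a) \<Rightarrow> bool"
  where "averaged H \<alpha> R \<longleftrightarrow>
    (\<exists>Q. nonexpansive H Q \<and>
      (\<forall>x\<in>carrier H. R x = ((1 - \<alpha>) \<odot>\<^bsub>H\<^esub> x) \<oplus>\<^bsub>H\<^esub> (\<alpha> \<odot>\<^bsub>H\<^esub> Q x)))"

text \<open>The real line as a Hilbert space, so that \<open>averaged\<close> also applies to functions on it.\<close>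

definition real_line :: "real inner_space"
  where "real_line =
    \<lparr>carrier = UNIV, monoid.mult = (*), one = 1, ring.zero = 0, add = (+), smult = (*), ip = (*)\<rparr>"

subsection \<open>Compositions\<close>

text \<open>\<open>compose_upto f m = f m \<circ> \<dots> \<circ> f 1\<close>\<close>

primrec compose_upto :: "(nat \<Rightarrow> 'a \<Rightarrow> 'a) \<Rightarrow> nat \<Rightarrow> 'a \<Rightarrow> 'a"
  where
    "compose_upto f 0 = (\<lambda>x. x)"
  | "compose_upto f (Suc n) = f (Suc n) \<circ> compose_upto f n"

subsection \<open>The definitions fit the library notions\<close>

lemma vector_norm_metric_space:
  assumes V: "real_vector_space V" and N: "vector_norm V N"
  shows "Metric_space (carrier V) (norm_dist V N)"
proof -
  interpret V: Module.module real_ring V by (rule V)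
  have neg: "N (\<ominus>\<^bsub>V\<^esub> x) = N x" if x: "x \<in> carrier V" for x
  proof -
    have "N ((- 1) \<odot>\<^bsub>V\<^esub> x) = N x"
      using N x by (simp add: vector_norm_def)
    moreover have "(- 1) \<odot>\<^bsub>V\<^esub> x = \<ominus>\<^bsub>V\<^esub> x"
    proof -
      have one: "1 \<odot>\<^bsub>V\<^esub> x = x"
        using V.smult_one[OF x] by (simp add: real_ring_def)
      have "(- 1) \<odot>\<^bsub>V\<^esub> x \<oplus>\<^bsub>V\<^esub> 1 \<odot>\<^bsub>V\<^esub> x = 0 \<odot>\<^bsub>V\<^esub> x"
        using V.smult_l_distr[of "- 1" 1 x] x by (simp add: real_ring_def)
      moreover have "0 \<odot>\<^bsub>V\<^esub> x = \<zero>\<^bsub>V\<^esub>"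
        using V.smult_l_null[OF x] by (simp add: real_ring_def)
      moreover have "(- 1) \<odot>\<^bsub>V\<^esub> x \<in> carrier V"
        using V.smult_closed[of "- 1" x] x by (simp add: real_ring_def)
      ultimately show ?thesis
        using one x V.minus_equality by metis
    qed
    ultimately show ?thesis by simp
  qed
  show ?thesis
  proof
    fix x y
    show "0 \<le> norm_dist V N x y"
      using N by (simp add: norm_dist_def vector_norm_def)
    show "norm_dist V N x y = norm_dist V N y x"
    proof (cases "x \<in> carrier V \<and> y \<in> carrier V")
      case True
      then have "\<ominus>\<^bsub>V\<^esub> (x \<ominus>\<^bsub>V\<^esub> y) = y \<ominus>\<^bsub>V\<^esub> x"
        by (simp add: a_minus_def V.minus_add V.a_comm)
      then show ?thesis
        using True neg[of "x \<ominus>\<^bsub>V\<^esub> y"] by (simp add: norm_dist_def)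
    qed (auto simp: norm_dist_def)
  next
    fix x y assume xy: "x \<in> carrier V" "y \<in> carrier V"
    have "N (x \<ominus>\<^bsub>V\<^esub> y) = 0 \<longleftrightarrow> x \<ominus>\<^bsub>V\<^esub> y = \<zero>\<^bsub>V\<^esub>"
      using N xy by (simp add: vector_norm_def)
    also have "\<dots> \<longleftrightarrow> x = y"
      using xy by (metis V.minus_equality V.minus_minus V.r_neg V.a_inv_closed a_minus_def)
    finally show "norm_dist V N x y = 0 \<longleftrightarrow> x = y"
      using xy by (simp add: norm_dist_def)
  next
    fix x y z assume xyz: "x \<in> carrier V" "y \<in> carrier V" "z \<in> carrier V"
    have "x \<ominus>\<^bsub>V\<^esub> z = (x \<ominus>\<^bsub>V\<^esub> y) \<oplus>\<^bsub>V\<^esub> (y \<ominus>\<^bsub>V\<^esub> z)"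
      using xyz by (simp add: a_minus_def V.a_assoc V.r_neg1)
    then show "norm_dist V N x z \<le> norm_dist V N x y + norm_dist V N y z"
      using N xyz by (simp add: norm_dist_def vector_norm_def)
  qed
qed

lemma inner_product_norm:
  assumes H: "inner_product_space H"
  shows "vector_norm H (hnorm H)"
proof -
  interpret V: Module.module real_ring H
    using H by (simp add: inner_product_space_def)
  have sym: "ip H x y = ip H y x" if "x \<in> carrier H" "y \<in> carrier H" for x y
    using H that by (auto simp: inner_product_space_def)
  have addl: "ip H (x \<oplus>\<^bsub>H\<^esub> y) z = ip H x z + ip H y z"
    if "x \<in> carrier H" "y \<in> carrier H" "z \<in> carrier H" for x y z
    using H that by (auto simp: inner_product_space_def)
  have scl: "ip H (r \<odot>\<^bsub>H\<^esub> x) y = r * ip H x y" if "x \<in> carrier H" "y \<in> carrier H" for r x y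
    using H that by (auto simp: inner_product_space_def)
  have cl: "r \<odot>\<^bsub>H\<^esub> x \<in> carrier H" if "x \<in> carrier H" for r x
    using V.smult_closed[of r x] that by (simp add: real_ring_def)
  have zero: "ip H \<zero>\<^bsub>H\<^esub> x = 0" if "x \<in> carrier H" for x
    using addl[of "\<zero>\<^bsub>H\<^esub>" "\<zero>\<^bsub>H\<^esub>" x] that by simp
  have pos: "0 < ip H x x" if "x \<in> carrier H" "x \<noteq> \<zero>\<^bsub>H\<^esub>" for x
    using H that by (auto simp: inner_product_space_def)
  have nonneg: "0 \<le> ip H x x" if "x \<in> carrier H" for x
    using pos[OF that] zero[OF that] by (cases "x = \<zero>\<^bsub>H\<^esub>") auto
  have addr: "ip H z (x \<oplus>\<^bsub>H\<^esub> y) = ip H z x + ip H z y"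
    if "x \<in> carrier H" "y \<in> carrier H" "z \<in> carrier H" for x y z
    using that by (simp add: sym[of z] addl)
  have scr: "ip H y (r \<odot>\<^bsub>H\<^esub> x) = r * ip H y x" if "x \<in> carrier H" "y \<in> carrier H" for r x y
    using that cl by (simp add: sym[of y] scl)
  have cs: "ip H x y \<le> hnorm H x * hnorm H y" if x: "x \<in> carrier H" and y: "y \<in> carrier H" for x y
  proof (cases "x = \<zero>\<^bsub>H\<^esub>")
    case True
    then show ?thesis using zero y x by (simp add: hnorm_def)
  next
    case False
    define p q r where "p = ip H x x" and "q = ip H y y" and "r = ip H x y"
    have p: "0 < p" using pos x False by (simp add: p_def)
    have "0 \<le> ip H ((- r) \<odot>\<^bsub>H\<^esub> x \<oplus>\<^bsub>H\<^esub> p \<odot>\<^bsub>H\<^esub> y) ((- r) \<odot>\<^bsub>H\<^esub> x \<oplus>\<^bsub>H\<^esub> p \<odot>\<^bsub>H\<^esub> y)"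
      using x y cl by (intro nonneg) simp
    also have "\<dots> = p * (p * q - r\<^sup>2)"
      using x y cl
      by (simp add: addl addr scl scr sym[of y x] flip: p_def q_def r_def)
        (simp add: algebra_simps power2_eq_square)
    finally have "r\<^sup>2 \<le> p * q"
      using p by (simp add: zero_le_mult_iff)
    then show ?thesis
      by (metis hnorm_def p_def q_def r_def real_le_rsqrt real_sqrt_mult)
  qed
  have "hnorm H (x \<oplus>\<^bsub>H\<^esub> y) \<le> hnorm H x + hnorm H y"
    if x: "x \<in> carrier H" and y: "y \<in> carrier H" for x y
  proof -
    have "ip H (x \<oplus>\<^bsub>H\<^esub> y) (x \<oplus>\<^bsub>H\<^esub> y) = ip H x x + 2 * ip H x y + ip H y y"
      using x y by (simp add: addl addr sym[of y x])
    also have "\<dots> \<le> (hnorm H x + hnorm H y)\<^sup>2"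
      using cs[OF x y] nonneg x y by (simp add: power2_sum hnorm_def)
    finally show ?thesis
      using nonneg x y by (simp add: hnorm_def real_le_lsqrt)
  qed
  moreover have "hnorm H x = 0 \<longleftrightarrow> x = \<zero>\<^bsub>H\<^esub>" if "x \<in> carrier H" for x
    using pos[OF that] zero[OF that] that by (fastforce simp: hnorm_def)
  moreover have "hnorm H (r \<odot>\<^bsub>H\<^esub> x) = \<bar>r\<bar> * hnorm H x" if "x \<in> carrier H" for r x
    using that cl by (simp add: hnorm_def scl scr real_sqrt_mult flip: mult.assoc)
  ultimately show ?thesis
    using nonneg by (simp add: vector_norm_def hnorm_def)
qed

lemma real_line_hilbert_space: "hilbert_space real_line"
proof -
  have ag: "abelian_group real_line"
  proof (rule abelian_groupI)
    show "\<exists>y\<in>carrier real_line. y \<oplus>\<^bsub>real_line\<^esub> x = \<zero>\<^bsub>real_line\<^esub>" for x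
      by (rule bexI[of _ "- x"]) (simp_all add: real_line_def)
  qed (simp_all add: real_line_def)
  have cr: "cring real_ring"
  proof (rule cringI)
    show "abelian_group real_ring"
    proof (rule abelian_groupI)
      show "\<exists>y\<in>carrier real_ring. y \<oplus>\<^bsub>real_ring\<^esub> x = \<zero>\<^bsub>real_ring\<^esub>" for x
        by (rule bexI[of _ "- x"]) (simp_all add: real_ring_def)
    qed (simp_all add: real_ring_def)
    show "comm_monoid real_ring"
      by unfold_locales (simp_all add: real_ring_def)
  qed (simp add: real_ring_def distrib_right)
  have vs: "real_vector_space real_line"
    by (rule moduleI[OF cr ag]) (simp_all add: real_line_def real_ring_def algebra_simps)
  have ips: "inner_product_space real_line"
    using vs by (auto simp: inner_product_space_def real_line_def algebra_simps zero_less_mult_iff)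
  interpret abelian_group real_line by (rule ag)
  have "\<ominus>\<^bsub>real_line\<^esub> x = - x" for x
    by (rule minus_equality) (simp_all add: real_line_def)
  then have "norm_dist real_line (hnorm real_line) = dist"
    by (intro ext) (simp add: norm_dist_def hnorm_def a_minus_def real_line_def dist_real_def)
  then show ?thesis
    using ips complete_UNIV by (simp add: hilbert_space_def real_line_def)
qed

end

theory Submission
  imports Defs
begin

text \<open>
  Fix two inputs and follow the difference \<open>u i\<close> of their trajectories after \<open>i\<close> layers. The
  difference quotients of an \<open>\<alpha>\<close>-averaged function on the line lie in \<open>[1 - 2 * \<alpha>, 1]\<close>
  (\<open>averaged_slope\<close>), so each layer multiplies every coordinate of \<open>W (Suc i) (u i)\<close> by a number in
  such an interval: \<open>u m\<close> is obtained from \<open>u 0\<close> by a product of the \<open>W i\<close> and of diagonal operators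
  whose multipliers depend on the two inputs. It remains to pass from multipliers in the interval
  to its two endpoints without increasing the bound.

  This is a maximum principle for convex functions, applied to one layer at a time
  (\<open>layered_extreme_points_bound\<close>): with the other layers fixed, the norm of the output is a convex
  function of the multipliers of the layer. There can be infinitely many of them, and the diagonal
  operators need not be in the convex hull of the extreme ones. Instead, the proof uses that each
  family of multipliers in the interval is the midpoint of an extreme family and of another family
  in the interval. If \<open>S\<close> bounds the values at extreme families and \<open>M\<close> is the supremum over all
  families, this gives \<open>M \<le> (S + M) / 2\<close>, hence \<open>M \<le> S\<close>
  (\<open>diagonal_extreme_points_bound\<close>). The argument needs \<open>M\<close> to be finite, which holds because
  multipliers in \<open>[-1, 1]\<close> do not increase the Hilbert norm, and it needs the diagonal operators
  with the new multipliers to exist, which is the Riesz--Fischer theorem. The two continuous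
  embeddings transfer Hilbert norm bounds to the given norms and make the supremum finite.
\<close>

section \<open>Inner product spaces with an explicit carrier\<close>

locale real_inner_product =
  fixes H :: "'a inner_space" (structure)
  assumes inner_product_space: "inner_product_space H"
begin

sublocale Module.module real_ring H
  using inner_product_space by (simp add: inner_product_space_def)

lemma scale_closed [simp, intro]: "x \<in> carrier H \<Longrightarrow> r \<odot> x \<in> carrier H"
  using smult_closed[of r x] by (simp add: real_ring_def)

lemma minus_in_carrier [simp, intro]:
  "x \<in> carrier H \<Longrightarrow> y \<in> carrier H \<Longrightarrow> x \<ominus> y \<in> carrier H"
  by simp

lemma ip_commute: "x \<in> carrier H \<Longrightarrow> y \<in> carrier H \<Longrightarrow> ip H x y = ip H y x"
  using inner_product_space unfolding inner_product_space_def by blast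

lemma ip_add_left [simp]:
  "x \<in> carrier H \<Longrightarrow> y \<in> carrier H \<Longrightarrow> z \<in> carrier H \<Longrightarrow>
    ip H (x \<oplus> y) z = ip H x z + ip H y z"
  using inner_product_space unfolding inner_product_space_def by blast

lemma ip_scale_left [simp]:
  "x \<in> carrier H \<Longrightarrow> y \<in> carrier H \<Longrightarrow> ip H (r \<odot> x) y = r * ip H x y"
  using inner_product_space unfolding inner_product_space_def by blast

lemma ip_zero_left [simp]: "x \<in> carrier H \<Longrightarrow> ip H \<zero> x = 0"
  using ip_add_left[of \<zero> \<zero> x] by simp

lemma ip_diff_left [simp]:
  assumes "x \<in> carrier H" "y \<in> carrier H" "z \<in> carrier H"
  shows "ip H (x \<ominus> y) z = ip H x z - ip H y z"
proof -
  have "x \<ominus> y \<oplus> y = x"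
    using assms by (simp add: a_minus_def a_assoc l_neg)
  then show ?thesis
    using ip_add_left[of "x \<ominus> y" y z] assms by simp
qed

lemma ip_diff_right [simp]:
  "x \<in> carrier H \<Longrightarrow> y \<in> carrier H \<Longrightarrow> z \<in> carrier H \<Longrightarrow>
    ip H z (x \<ominus> y) = ip H z x - ip H z y"
  by (simp add: ip_commute[of z])

lemma ip_finsum_left:
  assumes "finite F" "f \<in> F \<rightarrow> carrier H" "z \<in> carrier H"
  shows "ip H (finsum H f F) z = (\<Sum>k\<in>F. ip H (f k) z)"
  using assms by (induction F rule: finite_induct) auto

lemma ip_pos: "x \<in> carrier H \<Longrightarrow> x \<noteq> \<zero> \<Longrightarrow> 0 < ip H x x"
  using inner_product_space by (simp add: inner_product_space_def)

lemma ip_nonneg [simp]: "x \<in> carrier H \<Longrightarrow> 0 \<le> ip H x x"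
  using ip_pos[of x] by (cases "x = \<zero>") auto

lemma vector_norm_hnorm: "vector_norm H (hnorm H)"
  by (rule inner_product_norm[OF inner_product_space])

lemma hnorm_nonneg [simp]: "x \<in> carrier H \<Longrightarrow> 0 \<le> hnorm H x"
  by (simp add: hnorm_def)

lemma hnorm_power2: "x \<in> carrier H \<Longrightarrow> (hnorm H x)\<^sup>2 = ip H x x"
  by (simp add: hnorm_def)

lemma diff_eq_zero_iff: "x \<in> carrier H \<Longrightarrow> y \<in> carrier H \<Longrightarrow> x \<ominus> y = \<zero> \<longleftrightarrow> x = y"
  by (metis a_minus_def minus_equality minus_minus r_neg a_inv_closed)

text \<open>Testing against all vectors turns every identity between vectors into an identity between
  real numbers, which is how the vector space axioms are used from here on.\<close>

lemma ip_eqI: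
  assumes x: "x \<in> carrier H" and y: "y \<in> carrier H"
    and eq: "\<And>z. z \<in> carrier H \<Longrightarrow> ip H x z = ip H y z"
  shows "x = y"
proof -
  have "ip H (x \<ominus> y) (x \<ominus> y) = 0"
    using x y by (simp only: ip_diff_left minus_in_carrier eq diff_self)
  then show ?thesis
    using ip_pos[of "x \<ominus> y"] x y diff_eq_zero_iff by fastforce
qed

lemma Metric_space_hnorm: "Metric_space (carrier H) (norm_dist H (hnorm H))"
  by (rule vector_norm_metric_space) (use vector_norm_hnorm module_axioms in auto)

end

section \<open>Orthonormal bases and coordinates\<close>

locale hilbert_basis = real_inner_product H for H :: "'a inner_space" (structure) +
  fixes K :: "nat set" and e :: "nat \<Rightarrow> 'a"
  assumes complete: "Metric_space.mcomplete (carrier H) (norm_dist H (hnorm H))"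
    and basis: "orthonormal_basis H K e"
begin

lemma basis_in_carrier [simp, intro]: "k \<in> K \<Longrightarrow> e k \<in> carrier H"
  using basis by (simp add: orthonormal_basis_def)

lemma ip_basis: "j \<in> K \<Longrightarrow> k \<in> K \<Longrightarrow> ip H (e j) (e k) = (if j = k then 1 else 0)"
  using basis by (simp add: orthonormal_basis_def)

abbreviation combination :: "(nat \<Rightarrow> real) \<Rightarrow> nat set \<Rightarrow> 'a"
  where "combination a F \<equiv> finsum H (\<lambda>k. a k \<odot> e k) F"

lemma combination_closed [simp, intro]: "F \<subseteq> K \<Longrightarrow> combination a F \<in> carrier H"
  by (rule finsum_closed) auto

lemma ip_combination_left:
  assumes "finite F" "F \<subseteq> K" "x \<in> carrier H"
  shows "ip H (combination a F) x = (\<Sum>k\<in>F. a k * ip H x (e k))"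
proof -
  have "ip H (combination a F) x = (\<Sum>k\<in>F. ip H (a k \<odot> e k) x)"
    using assms by (intro ip_finsum_left) auto
  also have "\<dots> = (\<Sum>k\<in>F. a k * ip H x (e k))"
    using assms by (intro sum.cong) (auto simp: ip_commute[of x] subset_iff)
  finally show ?thesis .
qed

lemma ip_combination_right:
  assumes "finite F" "F \<subseteq> K" "x \<in> carrier H"
  shows "ip H x (combination a F) = (\<Sum>k\<in>F. a k * ip H x (e k))"
  using assms ip_combination_left[OF assms] by (simp add: ip_commute[of x])

lemma ip_combination_basis:
  assumes "finite F" "F \<subseteq> K" "j \<in> K"
  shows "ip H (combination a F) (e j) = (if j \<in> F then a j else 0)"
proof -
  have "ip H (combination a F) (e j) = (\<Sum>k\<in>F. a k * ip H (e j) (e k))"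
    using assms by (simp add: ip_combination_left)
  also have "\<dots> = (\<Sum>k\<in>F. if j = k then a k else 0)"
    using assms by (intro sum.cong) (auto simp: ip_basis subset_iff)
  finally show ?thesis
    using assms by simp
qed

text \<open>Completing the square. With the coordinates of \<open>s\<close> as coefficients the last sum vanishes: this
  choice gives the nearest point, and nonnegativity of the distance is Bessel's inequality.\<close>

lemma norm_diff_combination:
  assumes F: "finite F" "F \<subseteq> K" and s: "s \<in> carrier H"
  shows "(hnorm H (s \<ominus> combination a F))\<^sup>2
    = ip H s s - (\<Sum>k\<in>F. (ip H s (e k))\<^sup>2) + (\<Sum>k\<in>F. (ip H s (e k) - a k)\<^sup>2)"
proof -
  let ?p = "combination a F"
  have "ip H ?p ?p = (\<Sum>k\<in>F. a k * a k)"
    using F by (subst ip_combination_left) (auto intro!: sum.cong simp: ip_combination_basis subset_iff)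
  moreover have "(hnorm H (s \<ominus> ?p))\<^sup>2 = ip H s s - 2 * ip H s ?p + ip H ?p ?p"
    using F s by (simp add: hnorm_power2 ip_commute[of ?p s])
  ultimately have "(hnorm H (s \<ominus> ?p))\<^sup>2
      = ip H s s - 2 * (\<Sum>k\<in>F. a k * ip H s (e k)) + (\<Sum>k\<in>F. a k * a k)"
    using F s by (simp add: ip_combination_right)
  also have "\<dots> = ip H s s - (\<Sum>k\<in>F. (ip H s (e k))\<^sup>2) + (\<Sum>k\<in>F. (ip H s (e k) - a k)\<^sup>2)"
    by (simp add: power2_diff sum.distrib sum_subtractf sum_distrib_left algebra_simps)
      (simp add: power2_eq_square)
  finally show ?thesis .
qed

lemma bessel:
  assumes F: "finite F" "F \<subseteq> K" and s: "s \<in> carrier H"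
  shows "(\<Sum>k\<in>F. (ip H s (e k))\<^sup>2) \<le> ip H s s"
proof -
  have "0 \<le> (hnorm H (s \<ominus> combination (\<lambda>k. ip H s (e k)) F))\<^sup>2"
    by simp
  then show ?thesis
    unfolding norm_diff_combination[OF assms] by simp
qed

lemma coordinate_le_norm:
  assumes "k \<in> K" "s \<in> carrier H"
  shows "\<bar>ip H s (e k)\<bar> \<le> hnorm H s"
  using bessel[of "{k}" s] assms by (simp add: hnorm_def real_le_rsqrt)

text \<open>Density gives one finite combination close to \<open>s\<close>. Enlarging its index set and replacing its
  coefficients by the coordinates of \<open>s\<close> can only decrease the distance, because the partial
  expansion is the nearest point in the span.\<close>

lemma expansion_approximates:
  assumes s: "s \<in> carrier H" and \<epsilon>: "0 < \<epsilon>"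
  obtains F\<^sub>0 where "finite F\<^sub>0" "F\<^sub>0 \<subseteq> K"
    "\<And>F. finite F \<Longrightarrow> F\<^sub>0 \<subseteq> F \<Longrightarrow> F \<subseteq> K \<Longrightarrow>
      hnorm H (s \<ominus> combination (\<lambda>k. ip H s (e k)) F) < \<epsilon>"
proof -
  interpret M: Metric_space "carrier H" "norm_dist H (hnorm H)"
    by (rule Metric_space_hnorm)
  have "s \<in> hilbert_topology H closure_of finite_combinations H K e"
    using basis s by (simp add: orthonormal_basis_def)
  then obtain p where p: "p \<in> finite_combinations H K e" "p \<in> M.mball s \<epsilon>"
    using \<epsilon> unfolding norm_topology_def M.metric_closure_of by blast
  then obtain c F\<^sub>0 where F\<^sub>0: "finite F\<^sub>0" "F\<^sub>0 \<subseteq> K" "p = combination c F\<^sub>0"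
    by (auto simp: finite_combinations_def)
  then have close: "hnorm H (s \<ominus> combination c F\<^sub>0) < \<epsilon>"
    using p s by (simp add: norm_dist_def)
  show thesis
  proof (rule that[OF F\<^sub>0(1,2)])
    fix F assume F: "finite F" "F\<^sub>0 \<subseteq> F" "F \<subseteq> K"
    have "(\<Sum>k\<in>F\<^sub>0. (ip H s (e k))\<^sup>2) \<le> (\<Sum>k\<in>F. (ip H s (e k))\<^sup>2)"
      using F by (intro sum_mono2) auto
    moreover have "0 \<le> (\<Sum>k\<in>F\<^sub>0. (ip H s (e k) - c k)\<^sup>2)"
      by (simp add: sum_nonneg)
    ultimately have "(hnorm H (s \<ominus> combination (\<lambda>k. ip H s (e k)) F))\<^sup>2
        \<le> (hnorm H (s \<ominus> combination c F\<^sub>0))\<^sup>2"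
      using F F\<^sub>0 s by (simp add: norm_diff_combination)
    then have "hnorm H (s \<ominus> combination (\<lambda>k. ip H s (e k)) F)
        \<le> hnorm H (s \<ominus> combination c F\<^sub>0)"
      using F\<^sub>0 s by (intro power2_le_imp_le[OF _ hnorm_nonneg]) auto
    then show "hnorm H (s \<ominus> combination (\<lambda>k. ip H s (e k)) F) < \<epsilon>"
      using close by simp
  qed
qed

text \<open>Up to an arbitrarily small error, the norm of \<open>s\<close> is seen by finitely many coordinates, and on
  these Bessel's inequality for \<open>t\<close> applies. With \<open>t = \<zero>\<close> this says that coordinates separate
  vectors.\<close>

lemma norm_le_by_coordinates:
  assumes s: "s \<in> carrier H" and t: "t \<in> carrier H"
    and le: "\<And>k. k \<in> K \<Longrightarrow> \<bar>ip H s (e k)\<bar> \<le> \<bar>ip H t (e k)\<bar>"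
  shows "hnorm H s \<le> hnorm H t"
proof -
  have "ip H s s \<le> ip H t t + \<delta>" if \<delta>: "0 < \<delta>" for \<delta>
  proof -
    obtain F where F: "finite F" "F \<subseteq> K"
      and close: "hnorm H (s \<ominus> combination (\<lambda>k. ip H s (e k)) F) < sqrt \<delta>"
      using expansion_approximates[OF s, of "sqrt \<delta>"] \<delta> by (metis real_sqrt_gt_zero order_refl)
    have "(hnorm H (s \<ominus> combination (\<lambda>k. ip H s (e k)) F))\<^sup>2 \<le> (sqrt \<delta>)\<^sup>2"
      using close F s by (intro power_mono) auto
    then have "ip H s s \<le> (\<Sum>k\<in>F. (ip H s (e k))\<^sup>2) + \<delta>"
      using \<delta> by (simp add: norm_diff_combination[OF F s])
    also have "\<dots> \<le> (\<Sum>k\<in>F. (ip H t (e k))\<^sup>2) + \<delta>"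
      using le F by (auto intro!: sum_mono simp: abs_le_square_iff)
    also have "\<dots> \<le> ip H t t + \<delta>"
      using bessel[OF F t] by simp
    finally show ?thesis .
  qed
  then show ?thesis
    unfolding hnorm_def by (rule real_sqrt_le_mono[OF field_le_epsilon])
qed

lemma eq_by_coordinates:
  assumes x: "x \<in> carrier H" and y: "y \<in> carrier H"
    and eq: "\<And>k. k \<in> K \<Longrightarrow> ip H x (e k) = ip H y (e k)"
  shows "x = y"
proof -
  have "hnorm H (x \<ominus> y) \<le> hnorm H \<zero>"
    using x y by (intro norm_le_by_coordinates) (auto simp: eq)
  then have "ip H (x \<ominus> y) (x \<ominus> y) \<le> 0"
    by (simp add: hnorm_def)
  then show ?thesis
    using ip_pos[of "x \<ominus> y"] x y diff_eq_zero_iff by fastforce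
qed

text \<open>The Riesz--Fischer theorem. Completeness enters only here; it is what makes every diagonal
  operator with bounded coefficients exist.\<close>

lemma riesz_fischer:
  assumes B: "\<And>F. finite F \<Longrightarrow> F \<subseteq> K \<Longrightarrow> (\<Sum>k\<in>F. (a k)\<^sup>2) \<le> B"
  obtains s where "s \<in> carrier H" "\<And>k. k \<in> K \<Longrightarrow> ip H s (e k) = a k"
proof -
  interpret M: Metric_space "carrier H" "norm_dist H (hnorm H)"
    by (rule Metric_space_hnorm)
  define F where "F n = K \<inter> {..<n}" for n
  define t where "t n = combination a (F n)" for n
  define g where "g n = (\<Sum>k\<in>F n. (a k)\<^sup>2)" for n
  have F: "finite (F n)" "F n \<subseteq> K" for n
    by (auto simp: F_def)
  have t: "t n \<in> carrier H" for n
    using F by (auto simp: t_def)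
  have coord: "ip H (t n) (e k) = (if k < n then a k else 0)" if "k \<in> K" for n k
    using that F by (auto simp: t_def ip_combination_basis F_def)
  have dist_t: "(hnorm H (t n' \<ominus> t n))\<^sup>2 = g n' - g n" if "n \<le> n'" for n n'
  proof -
    have "F n \<subseteq> F n'"
      using that by (auto simp: F_def)
    have "(hnorm H (t n' \<ominus> t n))\<^sup>2 = ip H (t n' \<ominus> t n) (t n') - ip H (t n' \<ominus> t n) (t n)"
      using t by (simp add: hnorm_power2)
    also have "ip H (t n' \<ominus> t n) (t n) = (\<Sum>k\<in>F n. a k * ip H (t n' \<ominus> t n) (e k))"
      unfolding t_def[of n] using F t by (intro ip_combination_right) (auto simp flip: t_def)
    also have "\<dots> = 0"
      using t that F by (intro sum.neutral) (auto simp: coord F_def)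
    also have "ip H (t n' \<ominus> t n) (t n') = ip H (t n') (t n') - ip H (t n') (t n)"
      using t by (simp add: ip_commute)
    also have "ip H (t n') (t n') = g n'"
      unfolding t_def[of n'] g_def using F
      by (subst ip_combination_right) (auto intro!: sum.cong simp: ip_combination_basis power2_eq_square subset_iff)
    also have "ip H (t n') (t n) = g n"
      unfolding t_def g_def using F \<open>F n \<subseteq> F n'\<close>
      by (subst ip_combination_right)
        (auto intro!: sum.cong simp: ip_combination_basis power2_eq_square subset_iff)
    finally show ?thesis by simp
  qed
  have "incseq g"
    unfolding g_def by (intro monoI sum_mono2) (auto simp: F_def)
  then have "convergent g"
    using B F incseq_convergent[of g B] by (metis convergentI g_def)
  then have Cauchy: "Cauchy g"
    by (rule convergent_Cauchy)
  have "M.MCauchy t"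
    unfolding M.MCauchy_def
  proof (intro conjI allI impI)
    show "range t \<subseteq> carrier H"
      using t by auto
  next
    fix \<epsilon> :: real assume \<epsilon>: "0 < \<epsilon>"
    then obtain N where N: "\<And>n n'. N \<le> n \<Longrightarrow> N \<le> n' \<Longrightarrow> dist (g n) (g n') < \<epsilon>\<^sup>2"
      using Cauchy unfolding Cauchy_def by (metis zero_less_power)
    have le: "norm_dist H (hnorm H) (t n') (t n) < \<epsilon>" if "N \<le> n" "n \<le> n'" for n n'
    proof -
      have "(hnorm H (t n' \<ominus> t n))\<^sup>2 < \<epsilon>\<^sup>2"
        using N[of n n'] that dist_t[of n n'] by (simp add: dist_real_def)
      then show ?thesis
        using \<epsilon> t by (auto simp: norm_dist_def intro: power2_less_imp_less)
    qed
    show "\<exists>N. \<forall>n n'. N \<le> n \<longrightarrow> N \<le> n' \<longrightarrow> norm_dist H (hnorm H) (t n) (t n') < \<epsilon>"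
      using le by (metis M.commute nle_le)
  qed
  then obtain s where lim: "limitin M.mtopology t s sequentially"
    using complete by (auto simp: M.mcomplete_def)
  then have s: "s \<in> carrier H"
    by (simp add: M.limitin_metric)
  have "ip H s (e k) = a k" if k: "k \<in> K" for k
  proof -
    have "\<bar>a k - ip H s (e k)\<bar> \<le> \<epsilon>" if \<epsilon>: "0 < \<epsilon>" for \<epsilon>
    proof -
      have "\<forall>\<^sub>F n in sequentially. norm_dist H (hnorm H) (t n) s < \<epsilon>"
        using lim \<epsilon> t by (simp add: M.limitin_metric)
      then have "\<forall>\<^sub>F n in sequentially. norm_dist H (hnorm H) (t n) s < \<epsilon> \<and> k < n"
        by (intro eventually_conj eventually_gt_at_top)
      then obtain n where n: "norm_dist H (hnorm H) (t n) s < \<epsilon>" "k < n"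
        using eventually_happens' sequentially_bot by blast
      have "\<bar>ip H (t n \<ominus> s) (e k)\<bar> \<le> hnorm H (t n \<ominus> s)"
        using k s t by (intro coordinate_le_norm) auto
      then show ?thesis
        using n k s t by (simp add: coord norm_dist_def)
    qed
    then have "\<bar>a k - ip H s (e k)\<bar> \<le> 0"
      by (rule field_le_epsilon) simp
    then show ?thesis
      by simp
  qed
  then show thesis
    using that s by blast
qed

text \<open>Convergence of a series in the basis vectors says only what the coordinates of its sum are.
  Hence diagonal operators and coordinatewise activation functions are handled below by identities
  between coordinates, and no limit has to be taken.\<close>

lemma has_hilbert_sum_iff_coordinates:
  "has_hilbert_sum H (\<lambda>k. a k \<odot> e k) K s \<longleftrightarrow>
    s \<in> carrier H \<and> (\<forall>k\<in>K. ip H s (e k) = a k)"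
proof -
  interpret M: Metric_space "carrier H" "norm_dist H (hnorm H)"
    by (rule Metric_space_hnorm)
  show ?thesis
  proof (intro iffI conjI ballI)
    assume sum: "has_hilbert_sum H (\<lambda>k. a k \<odot> e k) K s"
    then show s: "s \<in> carrier H"
      by (simp add: has_hilbert_sum_def norm_topology_def M.limitin_metric)
    fix k assume k: "k \<in> K"
    have "\<bar>a k - ip H s (e k)\<bar> \<le> \<epsilon>" if \<epsilon>: "0 < \<epsilon>" for \<epsilon>
    proof -
      have "\<forall>\<^sub>F F in finite_subsets_at_top K.
          combination a F \<in> carrier H \<and> norm_dist H (hnorm H) (combination a F) s < \<epsilon>"
        using sum \<epsilon> by (simp add: has_hilbert_sum_def norm_topology_def M.limitin_metric)
      then obtain X where X: "finite X" "X \<subseteq> K"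
        "\<And>F. finite F \<Longrightarrow> X \<subseteq> F \<Longrightarrow> F \<subseteq> K \<Longrightarrow> norm_dist H (hnorm H) (combination a F) s < \<epsilon>"
        unfolding eventually_finite_subsets_at_top by metis
      let ?F = "insert k X"
      have F: "finite ?F" "?F \<subseteq> K"
        using X k by auto
      have "\<bar>ip H (combination a ?F \<ominus> s) (e k)\<bar> \<le> hnorm H (combination a ?F \<ominus> s)"
        using k s F by (intro coordinate_le_norm) (auto simp del: finsum_insert)
      moreover have "hnorm H (combination a ?F \<ominus> s) < \<epsilon>"
        using X(3)[of ?F] F s combination_closed[OF F(2), of a] 
        by (simp add: norm_dist_def subset_insertI del: finsum_insert)
      ultimately show ?thesis
        using k s F combination_closed[OF F(2), of a]
        by (simp add: ip_combination_basis del: finsum_insert)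
    qed
    then have "\<bar>a k - ip H s (e k)\<bar> \<le> 0"
      by (rule field_le_epsilon) simp
    then show "ip H s (e k) = a k"
      by simp
  next
    assume s: "s \<in> carrier H \<and> (\<forall>k\<in>K. ip H s (e k) = a k)"
    have "\<forall>\<^sub>F F in finite_subsets_at_top K.
        combination a F \<in> carrier H \<and> norm_dist H (hnorm H) (combination a F) s < \<epsilon>"
      if \<epsilon>: "0 < \<epsilon>" for \<epsilon>
    proof -
      obtain F\<^sub>0 where F\<^sub>0: "finite F\<^sub>0" "F\<^sub>0 \<subseteq> K"
        "\<And>F. finite F \<Longrightarrow> F\<^sub>0 \<subseteq> F \<Longrightarrow> F \<subseteq> K \<Longrightarrow>
          hnorm H (s \<ominus> combination (\<lambda>k. ip H s (e k)) F) < \<epsilon>"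
        using expansion_approximates[of s \<epsilon>] s \<epsilon> by metis
      have "norm_dist H (hnorm H) (combination a F) s < \<epsilon>"
        if F: "finite F" "F\<^sub>0 \<subseteq> F" "F \<subseteq> K" for F
      proof -
        have "combination a F = combination (\<lambda>k. ip H s (e k)) F"
          using F s by (intro finsum_cong') auto
        then have "norm_dist H (hnorm H) s (combination a F) < \<epsilon>"
          using F\<^sub>0(3)[OF F] s combination_closed[OF F(3)] by (simp add: norm_dist_def)
        then show ?thesis
          by (simp add: M.commute)
      qed
      then show ?thesis
        using F\<^sub>0 unfolding eventually_finite_subsets_at_top by blast
    qed
    then show "has_hilbert_sum H (\<lambda>k. a k \<odot> e k) K s"
      using s by (simp add: has_hilbert_sum_def norm_topology_def M.limitin_metric)
  qed
qed

end

section \<open>Diagonal operators\<close>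

context hilbert_basis
begin

lemma diagonal_operators_iff:
  "\<Lambda> \<in> diagonal_operators H K e I \<longleftrightarrow>
    \<Lambda> \<in> carrier H \<rightarrow> carrier H \<and>
    (\<exists>c. (\<forall>k\<in>K. c k \<in> I) \<and> (\<forall>x\<in>carrier H. \<forall>k\<in>K. ip H (\<Lambda> x) (e k) = c k * ip H x (e k)))"
  by (auto simp: diagonal_operators_def has_hilbert_sum_iff_coordinates Pi_iff)

lemma identity_in_diagonal_operators: "1 \<in> I \<Longrightarrow> (\<lambda>x. x) \<in> diagonal_operators H K e I"
  by (auto simp: diagonal_operators_iff intro!: exI[of _ "\<lambda>k. 1"])

lemma diagonal_operator_linear:
  assumes "\<Lambda> \<in> diagonal_operators H K e I"
  shows "linear_operator H H \<Lambda>"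
proof -
  obtain c where closed: "\<And>x. x \<in> carrier H \<Longrightarrow> \<Lambda> x \<in> carrier H"
    and c: "\<And>x k. x \<in> carrier H \<Longrightarrow> k \<in> K \<Longrightarrow> ip H (\<Lambda> x) (e k) = c k * ip H x (e k)"
    using assms unfolding diagonal_operators_iff by blast
  show ?thesis
    unfolding linear_operator_def
    by (auto intro!: eq_by_coordinates simp: closed c algebra_simps)
qed

lemma diagonal_operator_norm_le:
  assumes "\<Lambda> \<in> diagonal_operators H K e I" "I \<subseteq> {-1..1}" "x \<in> carrier H"
  shows "hnorm H (\<Lambda> x) \<le> hnorm H x"
proof -
  obtain c where closed: "\<Lambda> x \<in> carrier H" and I: "\<And>k. k \<in> K \<Longrightarrow> c k \<in> I"
    and c: "\<And>k. k \<in> K \<Longrightarrow> ip H (\<Lambda> x) (e k) = c k * ip H x (e k)"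
    using assms unfolding diagonal_operators_iff by blast
  have "\<bar>c k\<bar> \<le> 1" if "k \<in> K" for k
    using I[OF that] assms by (auto simp: abs_le_iff subset_iff)
  then show ?thesis
    using closed assms
    by (intro norm_le_by_coordinates) (auto simp: c abs_mult intro: mult_left_le_one_le)
qed

lemma diagonal_operator_exists:
  assumes c: "\<And>k. k \<in> K \<Longrightarrow> c k \<in> I" and I: "I \<subseteq> {-1..1}"
  shows "\<exists>\<Lambda>\<in>diagonal_operators H K e I.
    \<forall>x\<in>carrier H. \<forall>k\<in>K. ip H (\<Lambda> x) (e k) = c k * ip H x (e k)"
proof -
  have "\<exists>s. s \<in> carrier H \<and> (\<forall>k\<in>K. ip H s (e k) = c k * ip H x (e k))" if x: "x \<in> carrier H" for x
  proof -
    have c1: "\<bar>c k\<bar> \<le> 1" if "k \<in> K" for k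
      using c[OF that] I by (auto simp: abs_le_iff subset_iff)
    have "(\<Sum>k\<in>F. (c k * ip H x (e k))\<^sup>2) \<le> ip H x x" if F: "finite F" "F \<subseteq> K" for F
    proof -
      have "(\<Sum>k\<in>F. (c k * ip H x (e k))\<^sup>2) \<le> (\<Sum>k\<in>F. (ip H x (e k))\<^sup>2)"
        using c1 F by (intro sum_mono)
          (auto simp: power_mult_distrib abs_square_le_1 intro!: mult_left_le_one_le)
      then show ?thesis
        using bessel[OF F x] by simp
    qed
    from riesz_fischer[OF this] obtain s
      where "s \<in> carrier H" "\<And>k. k \<in> K \<Longrightarrow> ip H s (e k) = c k * ip H x (e k)"
      by blast
    then show ?thesis
      by blast
  qed
  then obtain \<Lambda> where \<Lambda>: "\<And>x. x \<in> carrier H \<Longrightarrow>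
      \<Lambda> x \<in> carrier H \<and> (\<forall>k\<in>K. ip H (\<Lambda> x) (e k) = c k * ip H x (e k))"
    by metis
  then have "\<Lambda> \<in> diagonal_operators H K e I"
    using c by (auto simp: diagonal_operators_iff)
  then show ?thesis
    using \<Lambda> by blast
qed

text \<open>If \<open>c'\<close> is the endpoint of \<open>[a, 1]\<close> nearer to \<open>c\<close>, its mirror image \<open>2 * c - c'\<close> in \<open>c\<close> is
  still in the interval. So every \<open>w\<close> with multipliers \<open>c\<close> is the midpoint of an extreme diagonal
  image of \<open>z\<close> and of a vector of the same kind as \<open>w\<close>. All coordinates are treated at once, and
  the finite supremum \<open>M\<close> of \<open>q\<close> over such vectors satisfies \<open>M \<le> (S + M) / 2\<close>.\<close>

lemma diagonal_extreme_points_bound: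
  assumes z: "z \<in> carrier H" and w: "w \<in> carrier H"
    and a: "-1 \<le> a" "a \<le> 1"
    and wz: "\<And>k. k \<in> K \<Longrightarrow> \<exists>c\<in>{a..1}. ip H w (e k) = c * ip H z (e k)"
    and mid: "\<And>x y. x \<in> carrier H \<Longrightarrow> y \<in> carrier H \<Longrightarrow>
      q ((1/2) \<odot> (x \<oplus> y)) \<le> (q x + q y) / 2"
    and C: "0 \<le> C" "\<And>x. x \<in> carrier H \<Longrightarrow> q x \<le> C * hnorm H x"
    and S: "\<And>\<Lambda>. \<Lambda> \<in> diagonal_operators H K e {a, 1} \<Longrightarrow> q (\<Lambda> z) \<le> (S::real)"
  shows "q w \<le> S"
proof -
  define D where "D = {w \<in> carrier H. \<forall>k\<in>K. \<exists>c\<in>{a..1}. ip H w (e k) = c * ip H z (e k)}"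
  define M where "M = Sup (q ` D)"
  have "q v \<le> C * hnorm H z" if v: "v \<in> D" for v
  proof -
    have "hnorm H v \<le> hnorm H z"
    proof (rule norm_le_by_coordinates)
      fix k assume "k \<in> K"
      then obtain c where c: "c \<in> {a..1}" "ip H v (e k) = c * ip H z (e k)"
        using v unfolding D_def by blast
      then have "\<bar>c\<bar> \<le> 1"
        using a by auto
      then show "\<bar>ip H v (e k)\<bar> \<le> \<bar>ip H z (e k)\<bar>"
        using c by (simp add: abs_mult mult_left_le_one_le)
    qed (use v z in \<open>auto simp: D_def\<close>)
    then show ?thesis
      using C v by (fastforce simp: D_def intro: order_trans mult_left_mono)
  qed
  then have "bdd_above (q ` D)"
    by (rule bdd_aboveI2)
  then have le_M: "q v \<le> M" if "v \<in> D" for v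
    using that unfolding M_def by (rule cSUP_upper2) simp
  have half: "q v \<le> (S + M) / 2" if v: "v \<in> D" for v
  proof -
    have "\<forall>k\<in>K. \<exists>c. c \<in> {a..1} \<and> ip H v (e k) = c * ip H z (e k)"
      using v unfolding D_def by blast
    then obtain c where c: "\<And>k. k \<in> K \<Longrightarrow> c k \<in> {a..1}"
      "\<And>k. k \<in> K \<Longrightarrow> ip H v (e k) = c k * ip H z (e k)"
      by metis
    \<comment> \<open>the nearer endpoint, so that \<open>2 * c k - c' k\<close> does not leave the interval\<close>
    define c' where "c' k = (if c k \<le> (a + 1) / 2 then a else 1)" for k
    have c': "c' k \<in> {a, 1}" if "k \<in> K" for k
      by (simp add: c'_def)
    have I: "{a, 1} \<subseteq> {-1..1}" "{a..1} \<subseteq> {-1..1}"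
      using a by auto
    obtain \<Lambda>' where \<Lambda>': "\<Lambda>' \<in> diagonal_operators H K e {a, 1}"
      "\<And>x k. x \<in> carrier H \<Longrightarrow> k \<in> K \<Longrightarrow> ip H (\<Lambda>' x) (e k) = c' k * ip H x (e k)"
      using diagonal_operator_exists[of c', OF c' I(1)] by metis
    have c'': "2 * c k - c' k \<in> {a..1}" if "k \<in> K" for k
      using c(1)[OF that] a by (auto simp: c'_def)
    obtain \<Lambda>'' where \<Lambda>'': "\<Lambda>'' \<in> diagonal_operators H K e {a..1}"
      "\<And>x k. x \<in> carrier H \<Longrightarrow> k \<in> K \<Longrightarrow> ip H (\<Lambda>'' x) (e k) = (2 * c k - c' k) * ip H x (e k)"
      using diagonal_operator_exists[of "\<lambda>k. 2 * c k - c' k", OF c'' I(2)] by metis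
    have closed: "\<Lambda>' z \<in> carrier H" "\<Lambda>'' z \<in> carrier H" "v \<in> carrier H"
      using \<Lambda>'(1) \<Lambda>''(1) v z by (auto simp: diagonal_operators_iff D_def)
    have "v = (1/2) \<odot> (\<Lambda>' z \<oplus> \<Lambda>'' z)"
      using closed z by (intro eq_by_coordinates) (auto simp: \<Lambda>' \<Lambda>'' c algebra_simps)
    then have "q v \<le> (q (\<Lambda>' z) + q (\<Lambda>'' z)) / 2"
      using mid[OF closed(1,2)] by simp
    moreover have "\<Lambda>'' z \<in> D"
      using closed c'' z by (auto simp: D_def \<Lambda>'')
    ultimately show ?thesis
      using S[OF \<Lambda>'(1)] le_M[of "\<Lambda>'' z"] by simp
  qed
  have "w \<in> D"
    using w wz by (simp add: D_def)
  then have "M \<le> (S + M) / 2"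
    unfolding M_def using half by (intro cSUP_least) (auto simp: M_def)
  then show ?thesis
    using le_M[OF \<open>w \<in> D\<close>] by simp
qed

end

section \<open>Compositions of bounded operators\<close>

lemma linear_operator_compose:
  assumes "linear_operator U V f" "linear_operator V X g"
  shows "linear_operator U X (g \<circ> f)"
  using assms by (auto simp: linear_operator_def Pi_iff)

lemma compose_upto_Suc_shift:
  "compose_upto f (Suc n) = compose_upto (\<lambda>i. f (Suc i)) n \<circ> f 1"
  by (induction n) (auto simp: fun_eq_iff)

lemma compose_upto_linear:
  assumes "\<And>i. i < n \<Longrightarrow> linear_operator (H i) (H (Suc i)) (f (Suc i))"
  shows "linear_operator (H 0) (H n) (compose_upto f n)"
  using assms
proof (induction n)
  case 0
  then show ?case by (simp add: linear_operator_def)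
next
  case (Suc n)
  then show ?case
    unfolding compose_upto.simps by (intro linear_operator_compose[where V = "H n"]) auto
qed

lemma compose_upto_norm_le:
  assumes "\<And>i. i < n \<Longrightarrow> linear_operator (H i) (H (Suc i)) (f (Suc i))"
    and "\<And>i. i < n \<Longrightarrow> 0 \<le> C i"
    and "\<And>i x. i < n \<Longrightarrow> x \<in> carrier (H i) \<Longrightarrow>
      hnorm (H (Suc i)) (f (Suc i) x) \<le> C i * hnorm (H i) x"
    and x: "x \<in> carrier (H 0)"
  shows "hnorm (H n) (compose_upto f n x) \<le> (\<Prod>i<n. C i) * hnorm (H 0) x"
  using assms(1-3)
proof (induction n)
  case 0
  then show ?case by simp
next
  case (Suc n)
  have "compose_upto f n x \<in> carrier (H n)"
    using compose_upto_linear[of n H f] Suc.prems(1) x by (auto simp: linear_operator_def)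
  then have "hnorm (H (Suc n)) (compose_upto f (Suc n) x) \<le> C n * hnorm (H n) (compose_upto f n x)"
    using Suc.prems(3)[of n] by simp
  also have "\<dots> \<le> C n * ((\<Prod>i<n. C i) * hnorm (H 0) x)"
    using Suc by (intro mult_left_mono) auto
  finally show ?case
    by (simp add: mult_ac)
qed

lemma bounded_operator_nonneg_bound:
  assumes "real_inner_product H" "bounded_operator H H' W"
  obtains C where "0 \<le> C" "\<And>x. x \<in> carrier H \<Longrightarrow> hnorm H' (W x) \<le> C * hnorm H x"
proof -
  interpret real_inner_product H by (rule assms)
  obtain C where C: "\<And>x. x \<in> carrier H \<Longrightarrow> hnorm H' (W x) \<le> C * hnorm H x"
    using assms(2) by (auto simp: bounded_operator_def)
  have "hnorm H' (W x) \<le> \<bar>C\<bar> * hnorm H x" if "x \<in> carrier H" for x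
    using that by (intro order_trans[OF C mult_right_mono]) auto
  then show thesis
    using that[of "\<bar>C\<bar>"] by simp
qed

text \<open>Continuity at the origin bounds \<open>N'\<close> on a ball of \<open>N\<close>, and homogeneity extends the bound to
  the whole space.\<close>

lemma continuously_embedded_bounded:
  assumes V: "real_vector_space V" and N: "vector_norm V N" and N': "vector_norm V N'"
    and emb: "continuously_embedded V N N'"
  obtains C where "0 \<le> C" "\<And>x. x \<in> carrier V \<Longrightarrow> N' x \<le> C * N x"
proof -
  interpret V: Module.module real_ring V by (rule V)
  interpret Metric_space12 "carrier V" "norm_dist V N" "carrier V" "norm_dist V N'"
    by (intro Metric_space12.intro vector_norm_metric_space V N N')
  have scale: "r \<odot>\<^bsub>V\<^esub> x \<in> carrier V" if "x \<in> carrier V" for r x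
    using V.smult_closed[of r x] that by (simp add: real_ring_def)
  have dist0: "norm_dist V L \<zero>\<^bsub>V\<^esub> x = L x" if "vector_norm V L" "x \<in> carrier V" for L x
  proof -
    interpret L: Metric_space "carrier V" "norm_dist V L"
      by (intro vector_norm_metric_space V that)
    have minus_zero: "\<ominus>\<^bsub>V\<^esub> \<zero>\<^bsub>V\<^esub> = \<zero>\<^bsub>V\<^esub>"
      by (intro V.minus_equality) auto
    have "norm_dist V L x \<zero>\<^bsub>V\<^esub> = L x"
      using that by (simp add: norm_dist_def a_minus_def minus_zero)
    then show ?thesis
      by (simp add: L.commute)
  qed
  have "\<exists>\<delta>>0. \<forall>x. x \<in> carrier V \<and> norm_dist V N \<zero>\<^bsub>V\<^esub> x < \<delta> \<longrightarrow> norm_dist V N' \<zero>\<^bsub>V\<^esub> x < 1"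
    using emb V.zero_closed zero_less_one
    unfolding continuously_embedded_def norm_topology_def
      M1.metric_continuous_map[OF M2.Metric_space_axioms] by blast
  then obtain \<delta> where \<delta>: "0 < \<delta>" "\<And>x. x \<in> carrier V \<Longrightarrow> N x < \<delta> \<Longrightarrow> N' x < 1"
    by (metis dist0 N N')
  have "N' x \<le> (2 / \<delta>) * N x" if x: "x \<in> carrier V" for x
  proof (cases "x = \<zero>\<^bsub>V\<^esub>")
    case True
    then have "N x = 0" "N' x = 0"
      using N N' x unfolding vector_norm_def by blast+
    then show ?thesis by simp
  next
    case False
    then have pos: "0 < N x"
      using N x by (metis vector_norm_def order_le_less)
    define r where "r = \<delta> / (2 * N x)"
    have r: "0 < r"
      using pos \<delta> by (simp add: r_def)
    have scaled: "L (r \<odot>\<^bsub>V\<^esub> x) = r * L x" if "vector_norm V L" for L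
    proof -
      have "L (r \<odot>\<^bsub>V\<^esub> x) = \<bar>r\<bar> * L x"
        using that x unfolding vector_norm_def by blast
      then show ?thesis
        using r by simp
    qed
    have "N (r \<odot>\<^bsub>V\<^esub> x) = \<delta> / 2"
      using pos unfolding scaled[OF N] by (simp add: r_def)
    then have "N' (r \<odot>\<^bsub>V\<^esub> x) < 1"
      using \<delta> x scale by simp
    moreover have "N' (r \<odot>\<^bsub>V\<^esub> x) = r * N' x"
      by (rule scaled[OF N'])
    ultimately have "r * N' x \<le> 1"
      by simp
    then show ?thesis
      using pos \<delta>(1) by (simp add: r_def field_simps)
  qed
  then show thesis
    using that[of "2 / \<delta>"] \<delta> by simp
qed

lemma linear_operator_ip_diff:
  assumes "real_inner_product U" "real_inner_product V" "linear_operator U V L"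
    and x: "x \<in> carrier U" "y \<in> carrier U" and z: "z \<in> carrier V"
  shows "ip V (L (x \<ominus>\<^bsub>U\<^esub> y)) z = ip V (L x) z - ip V (L y) z"
proof -
  interpret U: real_inner_product U by (rule assms)
  interpret V: real_inner_product V by (rule assms)
  have closed: "L v \<in> carrier V" if "v \<in> carrier U" for v
    using that assms(3) by (auto simp: linear_operator_def)
  have "(x \<ominus>\<^bsub>U\<^esub> y) \<oplus>\<^bsub>U\<^esub> y = x"
    using x by (intro U.ip_eqI) auto
  then have "L x = L (x \<ominus>\<^bsub>U\<^esub> y) \<oplus>\<^bsub>V\<^esub> L y"
    using assms(3) x by (metis linear_operator_def U.minus_in_carrier)
  then show ?thesis
    using closed x z by simp
qed

lemma operator_norm_bound:
  assumes U: "real_inner_product U" and V: "real_inner_product V" and L: "linear_operator U V L"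
    and N: "vector_norm U N" and N': "vector_norm V N'"
    and le: "operator_norm U N N' L \<le> ereal \<theta>" and x: "x \<in> carrier U"
  shows "N' (L x) \<le> \<theta> * N x"
proof -
  interpret U: real_inner_product U by (rule U)
  interpret V: real_inner_product V by (rule V)
  have scale: "N' (L (r \<odot>\<^bsub>U\<^esub> x)) = \<bar>r\<bar> * N' (L x)" "N (r \<odot>\<^bsub>U\<^esub> x) = \<bar>r\<bar> * N x" for r
  proof -
    have "L (r \<odot>\<^bsub>U\<^esub> x) = r \<odot>\<^bsub>V\<^esub> L x" "L x \<in> carrier V"
      using L x by (auto simp: linear_operator_def)
    then show "N' (L (r \<odot>\<^bsub>U\<^esub> x)) = \<bar>r\<bar> * N' (L x)"
      using N' unfolding vector_norm_def by metis
    show "N (r \<odot>\<^bsub>U\<^esub> x) = \<bar>r\<bar> * N x"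
      using N x unfolding vector_norm_def by blast
  qed
  show ?thesis
  proof (cases "N x = 0")
    case True
    then have "x = \<zero>\<^bsub>U\<^esub>"
      using N x by (simp add: vector_norm_def)
    then have "0 \<odot>\<^bsub>U\<^esub> x = x"
      by (intro U.ip_eqI) auto
    then have "N' (L x) = 0"
      using scale(1)[of 0] by simp
    then show ?thesis
      using True by simp
  next
    case False
    then have pos: "0 < N x"
      using N x unfolding vector_norm_def by (metis order_le_less)
    have "ereal (N' (L ((1 / N x) \<odot>\<^bsub>U\<^esub> x))) \<le> operator_norm U N N' L"
      unfolding operator_norm_def using x pos by (intro SUP_upper) (simp add: scale)
    then have "N' (L ((1 / N x) \<odot>\<^bsub>U\<^esub> x)) \<le> \<theta>"
      using le by (metis ereal_less_eq(3) order_trans)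
    then show ?thesis
      using pos by (simp add: scale field_simps)
  qed
qed

section \<open>Averaged functions on the line\<close>

text \<open>If \<open>s\<close> is a difference quotient of the nonexpansive part \<open>Q\<close>, then \<open>1 - \<alpha> + \<alpha> * s\<close> is one of
  \<open>\<rho>\<close>, and \<open>\<bar>s\<bar> \<le> 1\<close>.\<close>

lemma averaged_slope:
  assumes av: "averaged real_line \<alpha> \<rho>" and \<alpha>: "0 \<le> \<alpha>"
  shows "\<exists>c\<in>{1 - 2 * \<alpha>..1}. \<rho> x - \<rho> y = c * (x - y)"
proof -
  interpret real_inner_product real_line
    using real_line_hilbert_space by unfold_locales (simp add: hilbert_space_def)
  have minus: "s \<ominus>\<^bsub>real_line\<^esub> t = s - t" for s t
    using ip_diff_left[of s t 1] by (simp add: real_line_def)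
  obtain Q where "nonexpansive real_line Q"
    and "\<forall>x\<in>carrier real_line.
      \<rho> x = ((1 - \<alpha>) \<odot>\<^bsub>real_line\<^esub> x) \<oplus>\<^bsub>real_line\<^esub> (\<alpha> \<odot>\<^bsub>real_line\<^esub> Q x)"
    using av unfolding averaged_def by blast
  then have Q: "\<bar>Q x - Q y\<bar> \<le> \<bar>x - y\<bar>" and \<rho>: "\<rho> x = (1 - \<alpha>) * x + \<alpha> * Q x" for x y
    by (auto simp: nonexpansive_def lipschitz_constant_def minus)
      (simp_all add: real_line_def hnorm_def)
  show ?thesis
  proof (cases "x = y")
    case True
    then show ?thesis
      \<comment> \<open>any multiplier in the interval would do\<close>
      using \<alpha> by (intro bexI[of _ 1]) auto
  next
    case False
    define s where "s = (Q x - Q y) / (x - y)"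
    have "\<bar>s\<bar> \<le> 1"
      using Q[of x y] False by (simp add: s_def)
    then have "\<bar>\<alpha> * s\<bar> \<le> \<alpha>"
      using \<alpha> by (simp add: abs_mult mult_left_le)
    then have "1 - \<alpha> + \<alpha> * s \<in> {1 - 2 * \<alpha>..1}"
      by (auto simp: abs_le_iff)
    moreover have "\<rho> x - \<rho> y = (1 - \<alpha> + \<alpha> * s) * (x - y)"
      using False by (simp add: \<rho> s_def distrib_right) (simp add: algebra_simps)
    ultimately show ?thesis
      by blast
  qed
qed

section \<open>Propagation through the layers\<close>

text \<open>The vectors \<open>u i\<close> stand for the differences of two trajectories after \<open>i\<close> layers. Extreme
  multipliers are traded for the true ones one layer at a time, starting from the first: with the
  multipliers of the later layers fixed, the norm of the output is a bounded seminorm of the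
  output of the first layer.\<close>

lemma layered_extreme_points_bound:
  assumes "\<And>i. i < m \<Longrightarrow> hilbert_basis (H (Suc i)) (K (Suc i)) (e (Suc i))"
    and "\<And>i. i \<le> m \<Longrightarrow> real_inner_product (H i)"
    and "\<And>i. i < m \<Longrightarrow> bounded_operator (H i) (H (Suc i)) (W (Suc i))"
    and "\<And>i. i < m \<Longrightarrow> a (Suc i) \<in> {-1..1}"
    and "\<And>i. i \<le> m \<Longrightarrow> u i \<in> carrier (H i)"
    and "\<And>i k. i < m \<Longrightarrow> k \<in> K (Suc i) \<Longrightarrow> \<exists>c\<in>{a (Suc i)..1}.
      ip (H (Suc i)) (u (Suc i)) (e (Suc i) k) = c * ip (H (Suc i)) (W (Suc i) (u i)) (e (Suc i) k)"
    and "vector_norm (H m) N"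
    and "0 \<le> B" "\<And>x. x \<in> carrier (H m) \<Longrightarrow> N x \<le> B * hnorm (H m) x"
    and "\<And>\<Lambda>. (\<And>i. i < m \<Longrightarrow>
        \<Lambda> (Suc i) \<in> diagonal_operators (H (Suc i)) (K (Suc i)) (e (Suc i)) {a (Suc i), 1}) \<Longrightarrow>
      N (compose_upto (\<lambda>i. \<Lambda> i \<circ> W i) m (u 0)) \<le> S"
  shows "N (u m) \<le> S"
  using assms
proof (induction m arbitrary: H K e W a u)
  case 0
  then show ?case by simp
next
  case (Suc m)
  note basis = Suc.prems(1) and inner = Suc.prems(2) and W = Suc.prems(3) and a = Suc.prems(4)
    and u = Suc.prems(5) and multipliers = Suc.prems(6) and N = Suc.prems(7)
    and B = Suc.prems(8,9) and S = Suc.prems(10)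
  interpret H1: hilbert_basis "H 1" "K 1" "e 1"
    using basis[of 0] by simp
  have "N (u (Suc m)) \<le> S"
  proof (rule Suc.IH[of "\<lambda>i. H (Suc i)" "\<lambda>i. K (Suc i)" "\<lambda>i. e (Suc i)" "\<lambda>i. W (Suc i)"
        "\<lambda>i. a (Suc i)" "\<lambda>i. u (Suc i)"])
    fix \<Lambda>
    assume \<Lambda>: "\<And>i. i < m \<Longrightarrow> \<Lambda> (Suc i) \<in> diagonal_operators
        (H (Suc (Suc i))) (K (Suc (Suc i))) (e (Suc (Suc i))) {a (Suc (Suc i)), 1}"
    define A where "A = compose_upto (\<lambda>i. \<Lambda> i \<circ> W (Suc i)) m"
    have lin: "linear_operator (H (Suc i)) (H (Suc (Suc i))) (\<Lambda> (Suc i) \<circ> W (Suc (Suc i)))"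
      if "i < m" for i
      using hilbert_basis.diagonal_operator_linear[OF basis \<Lambda>] W[of "Suc i"] that
      by (auto simp: bounded_operator_def intro: linear_operator_compose)
    have A: "linear_operator (H 1) (H (Suc m)) A"
      unfolding A_def using compose_upto_linear[of m "\<lambda>i. H (Suc i)"] lin by simp
    have "\<exists>C\<ge>0. \<forall>x\<in>carrier (H (Suc i)).
        hnorm (H (Suc (Suc i))) ((\<Lambda> (Suc i) \<circ> W (Suc (Suc i))) x) \<le> C * hnorm (H (Suc i)) x"
      if i: "i < m" for i
    proof -
      interpret hilbert_basis "H (Suc (Suc i))" "K (Suc (Suc i))" "e (Suc (Suc i))"
        using basis i by simp
      obtain C where C: "0 \<le> C" "\<And>x. x \<in> carrier (H (Suc i)) \<Longrightarrow>
          hnorm (H (Suc (Suc i))) (W (Suc (Suc i)) x) \<le> C * hnorm (H (Suc i)) x"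
        using bounded_operator_nonneg_bound inner[of "Suc i"] W[of "Suc i"] i
        by (metis Suc_less_eq less_imp_le less_SucI)
      have "W (Suc (Suc i)) x \<in> carrier (H (Suc (Suc i)))" if "x \<in> carrier (H (Suc i))" for x
        using W[of "Suc i"] i that by (auto simp: bounded_operator_def linear_operator_def)
      then show ?thesis
        using C diagonal_operator_norm_le[OF \<Lambda>[OF i]] a[of "Suc i"] i
        by (intro exI[of _ C]) (fastforce intro: order_trans)
    qed
    then obtain C where C: "\<And>i. i < m \<Longrightarrow> 0 \<le> C i"
      "\<And>i x. i < m \<Longrightarrow> x \<in> carrier (H (Suc i)) \<Longrightarrow>
        hnorm (H (Suc (Suc i))) ((\<Lambda> (Suc i) \<circ> W (Suc (Suc i))) x) \<le> C i * hnorm (H (Suc i)) x"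
      by metis
    have bound: "N (A x) \<le> B * (\<Prod>i<m. C i) * hnorm (H 1) x" if x: "x \<in> carrier (H 1)" for x
    proof -
      have "N (A x) \<le> B * hnorm (H (Suc m)) (A x)"
        using A x by (intro B) (auto simp: linear_operator_def)
      also have "hnorm (H (Suc m)) (A x) \<le> (\<Prod>i<m. C i) * hnorm (H 1) x"
        unfolding A_def
        using compose_upto_norm_le[of m "\<lambda>i. H (Suc i)" "\<lambda>i. \<Lambda> i \<circ> W (Suc i)" C x] lin C x by simp
      finally show ?thesis
        using B by (simp add: mult_left_mono mult.assoc)
    qed
    have "N (A (u 1)) \<le> S"
    proof (rule H1.diagonal_extreme_points_bound[where q = "\<lambda>x. N (A x)" and a = "a 1"
          and z = "W 1 (u 0)" and C = "B * (\<Prod>i<m. C i)"])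
      show "W 1 (u 0) \<in> carrier (H 1)"
        using W[of 0] u[of 0] by (auto simp: bounded_operator_def linear_operator_def)
      show "u 1 \<in> carrier (H 1)" "-1 \<le> a 1" "a 1 \<le> 1"
        using u[of 1] a[of 0] by auto
      show "\<exists>c\<in>{a 1..1}. ip (H 1) (u 1) (e 1 k) = c * ip (H 1) (W 1 (u 0)) (e 1 k)"
        if "k \<in> K 1" for k
        using multipliers[of 0 k] that by simp
      show "0 \<le> B * (\<Prod>i<m. C i)"
        using B C by (intro mult_nonneg_nonneg prod_nonneg) auto
      show "N (A ((1/2) \<odot>\<^bsub>H 1\<^esub> (x \<oplus>\<^bsub>H 1\<^esub> y))) \<le> (N (A x) + N (A y)) / 2"
        if xy: "x \<in> carrier (H 1)" "y \<in> carrier (H 1)" for x y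
      proof -
        interpret Hm: real_inner_product "H (Suc m)"
          using inner by simp
        have "A x \<in> carrier (H (Suc m))" "A y \<in> carrier (H (Suc m))"
          using A xy by (auto simp: linear_operator_def)
        moreover have "A ((1/2) \<odot>\<^bsub>H 1\<^esub> (x \<oplus>\<^bsub>H 1\<^esub> y))
            = (1/2) \<odot>\<^bsub>H (Suc m)\<^esub> (A x \<oplus>\<^bsub>H (Suc m)\<^esub> A y)"
          using A xy H1.a_closed[OF xy] unfolding linear_operator_def by metis
        ultimately show ?thesis
          using N by (simp add: vector_norm_def)
      qed
      show "N (A x) \<le> B * (\<Prod>i<m. C i) * hnorm (H 1) x" if "x \<in> carrier (H 1)" for x
        using bound[OF that] .
      show "N (A (\<Lambda>\<^sub>1 (W 1 (u 0)))) \<le> S" if "\<Lambda>\<^sub>1 \<in> diagonal_operators (H 1) (K 1) (e 1) {a 1, 1}" for \<Lambda>\<^sub>1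
      proof -
        \<comment> \<open>an extreme choice for all layers, with \<open>\<Lambda>\<^sub>1\<close> in front\<close>
        define \<Lambda>' where "\<Lambda>' i = (if i = 1 then \<Lambda>\<^sub>1 else \<Lambda> (i - 1))" for i
        have "N (compose_upto (\<lambda>i. \<Lambda>' i \<circ> W i) (Suc m) (u 0)) \<le> S"
        proof (rule S)
          fix i assume "i < Suc m"
          then show "\<Lambda>' (Suc i) \<in> diagonal_operators (H (Suc i)) (K (Suc i)) (e (Suc i)) {a (Suc i), 1}"
            using that \<Lambda>[of "i - 1"] by (cases i) (auto simp: \<Lambda>'_def)
        qed
        moreover have "compose_upto (\<lambda>i. \<Lambda>' (Suc i) \<circ> W (Suc i)) n = compose_upto (\<lambda>i. \<Lambda> i \<circ> W (Suc i)) n" for n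
          by (induction n) (auto simp: \<Lambda>'_def)
        ultimately show ?thesis
          unfolding compose_upto_Suc_shift A_def by (simp add: \<Lambda>'_def)
      qed
    qed
    then show "N (compose_upto (\<lambda>i. \<Lambda> i \<circ> W (Suc i)) m (u (Suc 0))) \<le> S"
      by (simp add: A_def)
  qed (use basis inner W a u multipliers N B in auto)
  then show ?case .
qed

theorem proposition5p6:
  fixes m :: nat
    and H :: "nat \<Rightarrow> 'a inner_space"
    and W :: "nat \<Rightarrow> 'a \<Rightarrow> 'a"
    and b :: "nat \<Rightarrow> 'a"
    and \<alpha> :: "nat \<Rightarrow> real"
    and R :: "nat \<Rightarrow> 'a \<Rightarrow> 'a"
    and K :: "nat \<Rightarrow> nat set"
    and e :: "nat \<Rightarrow> nat \<Rightarrow> 'a"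
    and \<rho> :: "nat \<Rightarrow> nat \<Rightarrow> real \<Rightarrow> real"
    and N\<^sub>0 N\<^sub>m :: "'a \<Rightarrow> real"
    and T :: "'a \<Rightarrow> 'a"
    and \<theta>\<^sub>m :: ereal
  assumes "2 \<le> m"
    and "\<forall>i\<in>{0..m}. hilbert_space (H i) \<and> carrier (H i) \<noteq> {\<zero>\<^bsub>H i\<^esub>}"
    and "\<forall>i\<in>{1..m}. bounded_operator (H (i - 1)) (H i) (W i)"
    and "\<forall>i\<in>{1..m}. b i \<in> carrier (H i)"
    and "\<forall>i\<in>{1..m}. \<alpha> i \<in> {0..1}"
    and "\<forall>i\<in>{1..m}. R i \<in> carrier (H i) \<rightarrow> carrier (H i) \<and> averaged (H i) (\<alpha> i) (R i)"
    and "T = compose_upto (\<lambda>i x. R i (W i x \<oplus>\<^bsub>H i\<^esub> b i)) m"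
    and "\<forall>i\<in>{1..m}. separable_space (hilbert_topology (H i))"
    and "\<forall>i\<in>{1..m}. K i \<noteq> {}"
    and "\<forall>i\<in>{1..m}. orthonormal_basis (H i) (K i) (e i)"
    and "\<forall>i\<in>{1..m}. \<forall>k\<in>K i. averaged real_line (\<alpha> i) (\<rho> i k) \<and> \<rho> i k 0 = 0"
    and "vector_norm (H 0) N\<^sub>0" and "continuously_embedded (H 0) N\<^sub>0 (hnorm (H 0))"
    and "vector_norm (H m) N\<^sub>m" and "continuously_embedded (H m) (hnorm (H m)) N\<^sub>m"
    and "\<forall>i\<in>{1..m}. \<forall>x\<in>carrier (H i).
      has_hilbert_sum (H i) (\<lambda>k. \<rho> i k (ip (H i) x (e i k)) \<odot>\<^bsub>H i\<^esub> e i k) (K i) (R i x)"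
    and "\<theta>\<^sub>m = (SUP \<Lambda>\<in>{\<Lambda>. \<forall>i\<in>{1..m}. \<Lambda> i \<in> diagonal_operators (H i) (K i) (e i) {1 - 2 * \<alpha> i, 1}}.
      operator_norm (H 0) N\<^sub>0 N\<^sub>m (compose_upto (\<lambda>i. \<Lambda> i \<circ> W i) m))"
  shows "\<exists>\<theta>. \<theta>\<^sub>m = ereal \<theta> \<and> lipschitz_constant (H 0) N\<^sub>0 (H m) N\<^sub>m T \<theta>"
proof -
  define a where "a i = 1 - 2 * \<alpha> i" for i
  define V where "V = {\<Lambda>. \<forall>i\<in>{1..m}. \<Lambda> i \<in> diagonal_operators (H i) (K i) (e i) {1 - 2 * \<alpha> i, 1}}"
  define A where "A \<Lambda> = compose_upto (\<lambda>i. \<Lambda> i \<circ> W i) m" for \<Lambda>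
  define layer where "layer i x = R i (W i x \<oplus>\<^bsub>H i\<^esub> b i)" for i x
  have inner: "real_inner_product (H i)" if "i \<le> m" for i
    using assms(2) that by unfold_locales (simp add: hilbert_space_def)
  have basis: "hilbert_basis (H (Suc i)) (K (Suc i)) (e (Suc i))" if "i < m" for i
    using assms(2,10) that inner[of "Suc i"]
    by (intro hilbert_basis.intro hilbert_basis_axioms.intro) (auto simp: hilbert_space_def)
  have W: "bounded_operator (H i) (H (Suc i)) (W (Suc i))" if "i < m" for i
    using bspec[OF assms(3), of "Suc i"] that by simp
  have W_linear: "linear_operator (H i) (H (Suc i)) (W (Suc i))" if "i < m" for i
    using W[OF that] by (simp add: bounded_operator_def)
  have a: "a (Suc i) \<in> {-1..1}" if "i < m" for i
    using bspec[OF assms(5), of "Suc i"] that by (simp add: a_def)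
  have V: "\<Lambda> (Suc i) \<in> diagonal_operators (H (Suc i)) (K (Suc i)) (e (Suc i)) {a (Suc i), 1}"
    if "\<Lambda> \<in> V" "i < m" for \<Lambda> i
    using that by (auto simp: V_def a_def)
  have VI: "\<Lambda> \<in> V"
    if "\<And>i. i < m \<Longrightarrow> \<Lambda> (Suc i) \<in> diagonal_operators (H (Suc i)) (K (Suc i)) (e (Suc i)) {a (Suc i), 1}"
    for \<Lambda>
    unfolding V_def
  proof safe
    fix i assume "i \<in> {1..m}"
    then show "\<Lambda> i \<in> diagonal_operators (H i) (K i) (e i) {1 - 2 * \<alpha> i, 1}"
      using that[of "i - 1"] by (cases i) (auto simp: a_def)
  qed
  have module: "real_vector_space (H i)" if "i \<le> m" for i
    using inner[OF that] by (simp add: real_inner_product_def inner_product_space_def)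

  obtain C\<^sub>0 where C\<^sub>0: "0 \<le> C\<^sub>0" "\<And>x. x \<in> carrier (H 0) \<Longrightarrow> hnorm (H 0) x \<le> C\<^sub>0 * N\<^sub>0 x"
    using continuously_embedded_bounded[OF module[of 0] assms(12) _ assms(13)]
      real_inner_product.vector_norm_hnorm[OF inner[of 0]] by auto
  obtain C\<^sub>m where C\<^sub>m: "0 \<le> C\<^sub>m" "\<And>x. x \<in> carrier (H m) \<Longrightarrow> N\<^sub>m x \<le> C\<^sub>m * hnorm (H m) x"
    using continuously_embedded_bounded[OF module[of m] _ assms(14,15)]
      real_inner_product.vector_norm_hnorm[OF inner[of m]] by auto
  have "\<exists>C\<ge>0. \<forall>x\<in>carrier (H i). hnorm (H (Suc i)) (W (Suc i) x) \<le> C * hnorm (H i) x"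
    if "i < m" for i
    using bounded_operator_nonneg_bound[OF inner W] that by (metis less_imp_le)
  then obtain C where C: "\<And>i. i < m \<Longrightarrow> 0 \<le> C i"
    "\<And>i x. i < m \<Longrightarrow> x \<in> carrier (H i) \<Longrightarrow>
      hnorm (H (Suc i)) (W (Suc i) x) \<le> C i * hnorm (H i) x"
    by metis

  have vertex_linear: "linear_operator (H i) (H (Suc i)) (\<Lambda> (Suc i) \<circ> W (Suc i))"
    if "\<Lambda> \<in> V" "i < m" for \<Lambda> i
    using hilbert_basis.diagonal_operator_linear[OF basis V] W_linear that
    by (metis linear_operator_compose)
  have vertex_norm: "hnorm (H (Suc i)) ((\<Lambda> (Suc i) \<circ> W (Suc i)) x) \<le> C i * hnorm (H i) x"
    if "\<Lambda> \<in> V" and i: "i < m" and x: "x \<in> carrier (H i)" for \<Lambda> i x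
  proof -
    have "W (Suc i) x \<in> carrier (H (Suc i))"
      using W_linear[OF i] x by (auto simp: linear_operator_def)
    then have "hnorm (H (Suc i)) (\<Lambda> (Suc i) (W (Suc i) x)) \<le> hnorm (H (Suc i)) (W (Suc i) x)"
      using hilbert_basis.diagonal_operator_norm_le[OF basis[OF i] V[OF that(1) i]] a[OF i] by auto
    then show ?thesis
      using C(2)[OF i x] by simp
  qed
  have A_linear: "linear_operator (H 0) (H m) (A \<Lambda>)" if "\<Lambda> \<in> V" for \<Lambda>
    unfolding A_def using vertex_linear[OF that] by (rule compose_upto_linear)
  have A_bound: "N\<^sub>m (A \<Lambda> x) \<le> C\<^sub>m * ((\<Prod>i<m. C i) * C\<^sub>0) * N\<^sub>0 x"
    if \<Lambda>: "\<Lambda> \<in> V" and x: "x \<in> carrier (H 0)" for \<Lambda> x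
  proof -
    have "hnorm (H m) (A \<Lambda> x) \<le> (\<Prod>i<m. C i) * hnorm (H 0) x"
      unfolding A_def
      by (rule compose_upto_norm_le[where f = "\<lambda>i. \<Lambda> i \<circ> W i",
            OF vertex_linear[OF \<Lambda>] C(1) vertex_norm[OF \<Lambda>] x])
    also have "\<dots> \<le> (\<Prod>i<m. C i) * (C\<^sub>0 * N\<^sub>0 x)"
      using C C\<^sub>0 x by (intro mult_left_mono prod_nonneg) auto
    finally have "C\<^sub>m * hnorm (H m) (A \<Lambda> x) \<le> C\<^sub>m * ((\<Prod>i<m. C i) * (C\<^sub>0 * N\<^sub>0 x))"
      using C\<^sub>m by (intro mult_left_mono) auto
    moreover have "N\<^sub>m (A \<Lambda> x) \<le> C\<^sub>m * hnorm (H m) (A \<Lambda> x)"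
      using A_linear[OF \<Lambda>] x by (intro C\<^sub>m) (auto simp: linear_operator_def)
    ultimately show ?thesis
      by (simp add: mult.assoc)
  qed

  have \<theta>\<^sub>m: "\<theta>\<^sub>m = (SUP \<Lambda>\<in>V. operator_norm (H 0) N\<^sub>0 N\<^sub>m (A \<Lambda>))"
    using assms(17) by (simp add: V_def A_def)
  have "operator_norm (H 0) N\<^sub>0 N\<^sub>m (A \<Lambda>) \<le> ereal (C\<^sub>m * ((\<Prod>i<m. C i) * C\<^sub>0))" if \<Lambda>: "\<Lambda> \<in> V" for \<Lambda>
    unfolding operator_norm_def
  proof (rule SUP_least)
    fix x assume x: "x \<in> {x \<in> carrier (H 0). N\<^sub>0 x \<le> 1}"
    have "N\<^sub>m (A \<Lambda> x) \<le> C\<^sub>m * ((\<Prod>i<m. C i) * C\<^sub>0) * N\<^sub>0 x"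
      using x by (intro A_bound[OF \<Lambda>]) auto
    also have "\<dots> \<le> C\<^sub>m * ((\<Prod>i<m. C i) * C\<^sub>0)"
      using x C\<^sub>m C\<^sub>0 C by (intro mult_right_le_one_le mult_nonneg_nonneg prod_nonneg)
        (use assms(12) in \<open>auto simp: vector_norm_def\<close>)
    finally show "ereal (N\<^sub>m (A \<Lambda> x)) \<le> ereal (C\<^sub>m * ((\<Prod>i<m. C i) * C\<^sub>0))"
      by simp
  qed
  then have upper: "\<theta>\<^sub>m \<le> ereal (C\<^sub>m * ((\<Prod>i<m. C i) * C\<^sub>0))"
    unfolding \<theta>\<^sub>m by (rule SUP_least)
  \<comment> \<open>the set of extreme choices is nonempty, so the supremum is not \<open>-\<infinity>\<close>\<close>
  have lower: "0 \<le> \<theta>\<^sub>m"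
  proof -
    interpret H0: real_inner_product "H 0" by (rule inner) simp
    let ?I = "\<lambda>i x. x"
    have I: "?I \<in> V"
      using hilbert_basis.identity_in_diagonal_operators[OF basis] by (intro VI) auto
    have "N\<^sub>0 \<zero>\<^bsub>H 0\<^esub> = 0"
      using assms(12) H0.zero_closed unfolding vector_norm_def by blast
    then have zero: "\<zero>\<^bsub>H 0\<^esub> \<in> {x \<in> carrier (H 0). N\<^sub>0 x \<le> 1}"
      by simp
    have "0 \<le> N\<^sub>m (A ?I \<zero>\<^bsub>H 0\<^esub>)"
      using A_linear[OF I] assms(14) by (auto simp: linear_operator_def vector_norm_def)
    then have "0 \<le> ereal (N\<^sub>m (A ?I \<zero>\<^bsub>H 0\<^esub>))"
      by simp
    also have "\<dots> \<le> operator_norm (H 0) N\<^sub>0 N\<^sub>m (A ?I)"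
      unfolding operator_norm_def using zero by (rule SUP_upper)
    also have "\<dots> \<le> \<theta>\<^sub>m"
      unfolding \<theta>\<^sub>m using I by (rule SUP_upper)
    finally show ?thesis .
  qed
  obtain \<theta> where \<theta>: "\<theta>\<^sub>m = ereal \<theta>"
    using upper lower by (cases \<theta>\<^sub>m) auto
  have vertex_bound: "N\<^sub>m (A \<Lambda> x) \<le> \<theta> * N\<^sub>0 x" if \<Lambda>: "\<Lambda> \<in> V" and x: "x \<in> carrier (H 0)" for \<Lambda> x
  proof (rule operator_norm_bound[OF _ _ A_linear[OF \<Lambda>] assms(12,14) _ x])
    show "operator_norm (H 0) N\<^sub>0 N\<^sub>m (A \<Lambda>) \<le> ereal \<theta>"
      unfolding \<theta>[symmetric] \<theta>\<^sub>m using \<Lambda> by (rule SUP_upper)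
  qed (simp_all add: inner)

  have layer_closed: "layer (Suc i) x \<in> carrier (H (Suc i))"
    and argument_closed: "W (Suc i) x \<oplus>\<^bsub>H (Suc i)\<^esub> b (Suc i) \<in> carrier (H (Suc i))"
    and W_closed: "W (Suc i) x \<in> carrier (H (Suc i))"
    if i: "i < m" and x: "x \<in> carrier (H i)" for i x
  proof -
    interpret real_inner_product "H (Suc i)" using inner i by simp
    have b: "b (Suc i) \<in> carrier (H (Suc i))" and R: "R (Suc i) \<in> carrier (H (Suc i)) \<rightarrow> carrier (H (Suc i))"
      using assms(4,6) i by auto
    show Wx: "W (Suc i) x \<in> carrier (H (Suc i))"
      using W_linear[OF i] x by (auto simp: linear_operator_def)
    show *: "W (Suc i) x \<oplus>\<^bsub>H (Suc i)\<^esub> b (Suc i) \<in> carrier (H (Suc i))"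
      using Wx b by simp
    show "layer (Suc i) x \<in> carrier (H (Suc i))"
      unfolding layer_def using R * by blast
  qed
  have trajectory_closed: "compose_upto layer i x \<in> carrier (H i)"
    if "i \<le> m" "x \<in> carrier (H 0)" for i x
    using that by (induction i) (auto intro: layer_closed)
  have T: "T = compose_upto layer m"
    using assms(7) by (simp add: layer_def[abs_def])

  have "N\<^sub>m (T x \<ominus>\<^bsub>H m\<^esub> T y) \<le> \<theta> * N\<^sub>0 (x \<ominus>\<^bsub>H 0\<^esub> y)"
    if x: "x \<in> carrier (H 0)" and y: "y \<in> carrier (H 0)" for x y
  proof -
    define X where "X i = compose_upto layer i x" for i
    define Y where "Y i = compose_upto layer i y" for i
    define u where "u i = X i \<ominus>\<^bsub>H i\<^esub> Y i" for i
    have X: "X i \<in> carrier (H i)" and Y: "Y i \<in> carrier (H i)" if "i \<le> m" for i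
      using trajectory_closed that x y by (auto simp: X_def Y_def)
    have u: "u i \<in> carrier (H i)" if "i \<le> m" for i
      unfolding u_def using real_inner_product.minus_in_carrier[OF inner X Y] that by simp
    have "N\<^sub>m (u m) \<le> \<theta> * N\<^sub>0 (u 0)"
    proof (rule layered_extreme_points_bound[where H = H and K = K and e = e and W = W and a = a and u = u])
      fix i k assume i: "i < m" and k: "k \<in> K (Suc i)"
      interpret hilbert_basis "H (Suc i)" "K (Suc i)" "e (Suc i)"
        by (rule basis[OF i])
      let ?e = "e (Suc i) k"
      let ?p = "W (Suc i) (X i) \<oplus>\<^bsub>H (Suc i)\<^esub> b (Suc i)"
      let ?q = "W (Suc i) (Y i) \<oplus>\<^bsub>H (Suc i)\<^esub> b (Suc i)"
      have Xi: "X i \<in> carrier (H i)" and Yi: "Y i \<in> carrier (H i)"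
        using X Y i by auto
      have b: "b (Suc i) \<in> carrier (H (Suc i))"
        using assms(4) i by auto
      have R: "ip (H (Suc i)) (R (Suc i) v) ?e = \<rho> (Suc i) k (ip (H (Suc i)) v ?e)"
        if "v \<in> carrier (H (Suc i))" for v
        using bspec[OF assms(16), of "Suc i"] i that k by (auto simp: has_hilbert_sum_iff_coordinates)
      have "u (Suc i) = layer (Suc i) (X i) \<ominus>\<^bsub>H (Suc i)\<^esub> layer (Suc i) (Y i)"
        by (simp add: u_def X_def Y_def)
      then have "ip (H (Suc i)) (u (Suc i)) ?e
          = \<rho> (Suc i) k (ip (H (Suc i)) ?p ?e) - \<rho> (Suc i) k (ip (H (Suc i)) ?q ?e)"
        using layer_closed[OF i Xi] layer_closed[OF i Yi] k
          R[OF argument_closed[OF i Xi]] R[OF argument_closed[OF i Yi]]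
        by (simp add: layer_def)
      \<comment> \<open>the bias cancels in the difference of the arguments\<close>
      moreover have "ip (H (Suc i)) (W (Suc i) (u i)) ?e
          = ip (H (Suc i)) ?p ?e - ip (H (Suc i)) ?q ?e"
        using linear_operator_ip_diff[OF inner real_inner_product_axioms W_linear[OF i] Xi Yi, of ?e]
          W_closed[OF i Xi] W_closed[OF i Yi] b k i
        by (simp add: u_def)
      moreover have "\<exists>c\<in>{a (Suc i)..1}. \<rho> (Suc i) k s - \<rho> (Suc i) k t = c * (s - t)" for s t
        unfolding a_def using assms(5,11) i k by (intro averaged_slope) auto
      ultimately show "\<exists>c\<in>{a (Suc i)..1}.
          ip (H (Suc i)) (u (Suc i)) ?e = c * ip (H (Suc i)) (W (Suc i) (u i)) ?e"
        by simp
    next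
      fix \<Lambda>
      assume "\<And>i. i < m \<Longrightarrow>
        \<Lambda> (Suc i) \<in> diagonal_operators (H (Suc i)) (K (Suc i)) (e (Suc i)) {a (Suc i), 1}"
      then show "N\<^sub>m (compose_upto (\<lambda>i. \<Lambda> i \<circ> W i) m (u 0)) \<le> \<theta> * N\<^sub>0 (u 0)"
        using vertex_bound[OF VI u[of 0]] by (simp add: A_def)
    qed (use basis inner W a u assms(14) C\<^sub>m in auto)
    then show ?thesis
      by (simp add: u_def X_def Y_def T)
  qed
  then have "lipschitz_constant (H 0) N\<^sub>0 (H m) N\<^sub>m T \<theta>"
    using lower \<theta> by (auto simp: lipschitz_constant_def)
  with \<theta> show ?thesis
    by blast
qed

end
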